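(* Let $\mathcal{P}$ be an expansion proof of a sequent $\Gamma$, i.e. an expansion proof with $\mathrm{Sh}(\mathcal{P})=\Gamma$. Then there is an $\mathbf{LK}$-proof of $\Gamma$ (with sequents treated as sets of formulas). If $\mathcal{P}$ is cut-free (its sequence of cuts is empty), then there is a cut-free $\mathbf{LK}$-proof of $\Gamma$.
   Context: **Formulas.** Classical first-order logic; all formulas are in negation normal form and without vacuous quantifiers. $\overline{A}$ is the de Morgan dual of $A$. A literal is an atom $P(t_1,\ldots,t_n)$ or a negated atom $\overline{P}(t_1,\ldots,t_n)$. $A[t/x]$ is substitution of $t$ for $x$ in $A$. **The calculus $\mathbf{LK}$** (here sequents are finite sets of formulas, read disjunctively). Initial sequents: $\Gamma,A,\overline{A}$ for an atom $A$. Rules: ($\forall$) from $\Gamma,A[\alpha/x]$ infer $\Gamma,\forall x\,A$, where the variable $\alpha$ must not appear in $\Gamma,\forall x\,A$; ($\exists$) from $\Gamma,\exists x\,A,A[t/x]$ infer $\Gamma,\exists x\,A$, where $t$ must not contain a variable bound in $A$; ($\land$) from $\Gamma,A$ and $\Gamma,B$ infer $\Gamma,A\land B$; ($\lor$) from $\Gamma,A,B$ infer $\Gamma,A\lor B$; (cut) from $\Gamma,A$ and $\overline{A},\Gamma$ infer $\Gamma$. **Expansion trees and shallow formula $\mathrm{Sh}$**, defined inductively: (1) a literal $L$ is an expansion tree with $\mathrm{Sh}(L)=L$; (2) if $E_1,E_2$ are expansion trees and $\circ\in\{\land,\lor\}$, then $E_1\circ E_2$ is an expansion tree with $\mathrm{Sh}(E_1\circ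 E_2)=\mathrm{Sh}(E_1)\circ\mathrm{Sh}(E_2)$; (3) if $t_1,\ldots,t_n$ is a sequence of terms and $E_1,\ldots,E_n$ are expansion trees with $\mathrm{Sh}(E_i)=A[t_i/x]$ for all $i$, then $E=\exists x\,A+^{t_1}E_1\cdots+^{t_n}E_n$ is an expansion tree with $\mathrm{Sh}(E)=\exists x\,A$; (4) if $E_0$ is an expansion tree with $\mathrm{Sh}(E_0)=A[\alpha/x]$, $\alpha$ a variable, then $E=\forall x\,A+^{\alpha}E_0$ is an expansion tree with $\mathrm{Sh}(E)=\forall x\,A$. The $+^{t_i}$ in (3) are $\exists$-expansions, the $+^\alpha$ in (4) are $\forall$-expansions with eigenvariable $\alpha$; both are called expansions. $+^{t_i}$ dominates all expansions in $E_i$; $+^\alpha$ dominates all expansions in $E_0$. **Deep formula $\mathrm{Dp}$:** $\mathrm{Dp}(L)=L$, $\mathrm{Dp}(E_1\circ E_2)=\mathrm{Dp}(E_1)\circ\mathrm{Dp}(E_2)$, $\mathrm{Dp}(\exists x\,A+^{t_1}E_1\cdots+^{t_n}E_n)=\bigvee_{i=1}^n\mathrm{Dp}(E_i)$, $\mathrm{Dp}(\forall x\,A+^\alpha E_0)=\mathrm{Dp}(E_0)$. **Cuts.** A cut is a set $C=\{E_1,E_2\}$ of two expansion trees with $\mathrm{Sh}(E_1)=\overline{\mathrm{Sh}(E_2)}$. A formula is positive if it is a positive literal or its top connective is $\lor$ or $\exists$. Writing $C=(E_1,E_2)$ with $\mathrm{Sh}(E_1)$ positive, set $\mathrm{Sh}(C)=\mathrm{Sh}(E_1)$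 and $\mathrm{Dp}(C)=\mathrm{Dp}(E_1)\land\mathrm{Dp}(E_2)$. **Branches $\mathrm{Br}$.** A finite set of lists of formulas and integers $1,2$: $\mathrm{Br}(L)=\{L\}$; $\mathrm{Br}(E_1\circ E_2)=\{(\mathrm{Sh}(E_1\circ E_2),i,s)\mid i\in\{1,2\},\ s\in\mathrm{Br}(E_i)\}$; $\mathrm{Br}(\exists x\,A+^{t_1}E_1\cdots+^{t_n}E_n)=\{(\exists x\,A,s)\mid s\in\mathrm{Br}(E_i),\ 1\le i\le n\}$; $\mathrm{Br}(\forall x\,A+^\alpha E_0)=\{(\forall x\,A,s)\mid s\in\mathrm{Br}(E_0)\}$; for a cut, $\mathrm{Br}(\{E_1,E_2\})=\mathrm{Br}(E_1)\cup\mathrm{Br}(E_2)$. Commas denote concatenation of lists. **Dependency relation.** Let $\mathcal{P}=\mathcal{C},\mathcal{E}$ with $\mathcal{C}$ a finite sequence of cuts and $\mathcal{E}$ a finite sequence of expansion trees (sequences are identified modulo permutation). On occurrences of expansions and cuts in $\mathcal{P}$, $<^0$ is the least relation with: (1) $v<^0w$ if $w$ is an $\exists$-expansion whose term contains the eigenvariable of the $\forall$-expansion $v$; (2) $v<^0w$ if the expansion $v$ dominates the expansion $w$; (3) $C<^0v$ if $v$ is an expansion of the cut $C$ in $\mathcal{C}$; (4) $v<^0C$ if $C$ is a cut and $\mathrm{Sh}(C)$ contains the eigenvariable of the $\forall$-expansion $v$. $<_{\mathcal{P}}$ is the transitive closure of $<^0$. **Expansion proofs.** $\mathrm{Sh}(\mathcal{P})=\mathrm{Sh}(\mathcal{E})$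 is the sequent of the $\mathrm{Sh}$ of the trees in $\mathcal{E}$; $\mathrm{Dp}(\mathcal{P})=\mathrm{Dp}(\mathcal{E}),\mathrm{Dp}(\mathcal{C})$ is the sequent (read disjunctively) of the deep formulas of all trees and cuts. $\mathcal{P}$ is an expansion proof if: (1) (weak regularity) for all $S,T$ in $\mathcal{P}$, if $(s,\forall x A,A[\alpha/x],s')\in\mathrm{Br}(T)$ and $(r,\forall x B,B[\alpha/x],r')\in\mathrm{Br}(S)$, then $s=r$, $A=B$, and $S,T$ are both trees or both cuts; (2) (acyclicity) $x<_{\mathcal{P}}x$ for no $x$; (3) (validity) $\mathrm{Dp}(\mathcal{P})$ is a propositional tautology; (4) (eigenvariable condition) for every $\forall$-expansion $+^\alpha$ in $\mathcal{P}$, $\alpha$ does not occur in $\mathrm{Sh}(\mathcal{E})$. *)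

theory Defs
  imports Main "HOL-Library.Sublist"
begin

section \<open>Formulas\<close>

text \<open>
  Formulas are taken modulo renaming of bound variables, in locally nameless style:
  \<open>Var\<close> is a named (free) variable, \<open>Bnd i\<close> refers to the \<open>i\<close>-th enclosing quantifier.
  A symbol is identified by its name together with the number of its arguments.
\<close>

datatype ('f, 'v) tm = Var 'v | Bnd nat | Fn 'f "('f, 'v) tm list"

text \<open>
  \<open>Lit True P ts\<close> is an atom, \<open>Lit False P ts\<close> a negated atom. Negation occurs only in literals,
  so every formula is in negation normal form.
\<close>

datatype ('f, 'p, 'v) fm =
    Lit bool 'p "('f, 'v) tm list"
  | And "('f, 'p, 'v) fm" "('f, 'p, 'v) fm"
  | Or "('f, 'p, 'v) fm" "('f, 'p, 'v) fm"
  | Forall "('f, 'p, 'v) fm"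
  | Exists "('f, 'p, 'v) fm"

fun fv_tm :: "('f, 'v) tm \<Rightarrow> 'v set" where
  "fv_tm (Var a) = {a}"
| "fv_tm (Bnd i) = {}"
| "fv_tm (Fn f ts) = (\<Union>t\<in>set ts. fv_tm t)"

fun fv :: "('f, 'p, 'v) fm \<Rightarrow> 'v set" where
  "fv (Lit b P ts) = (\<Union>t\<in>set ts. fv_tm t)"
| "fv (And A B) = fv A \<union> fv B"
| "fv (Or A B) = fv A \<union> fv B"
| "fv (Forall A) = fv A"
| "fv (Exists A) = fv A"

text \<open>Dangling indices.\<close>

fun loose_tm :: "('f, 'v) tm \<Rightarrow> nat set" where
  "loose_tm (Var a) = {}"
| "loose_tm (Bnd i) = {i}"
| "loose_tm (Fn f ts) = (\<Union>t\<in>set ts. loose_tm t)"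

fun loose :: "('f, 'p, 'v) fm \<Rightarrow> nat set" where
  "loose (Lit b P ts) = (\<Union>t\<in>set ts. loose_tm t)"
| "loose (And A B) = loose A \<union> loose B"
| "loose (Or A B) = loose A \<union> loose B"
| "loose (Forall A) = {i. Suc i \<in> loose A}"
| "loose (Exists A) = {i. Suc i \<in> loose A}"

fun nonvacuous :: "('f, 'p, 'v) fm \<Rightarrow> bool" where
  "nonvacuous (Lit b P ts) \<longleftrightarrow> True"
| "nonvacuous (And A B) \<longleftrightarrow> nonvacuous A \<and> nonvacuous B"
| "nonvacuous (Or A B) \<longleftrightarrow> nonvacuous A \<and> nonvacuous B"
| "nonvacuous (Forall A) \<longleftrightarrow> 0 \<in> loose A \<and> nonvacuous A"
| "nonvacuous (Exists A) \<longleftrightarrow> 0 \<in> loose A \<and> nonvacuous A"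

definition wf_tm :: "('f, 'v) tm \<Rightarrow> bool" where
  "wf_tm t \<longleftrightarrow> loose_tm t = {}"

definition wf_fm :: "('f, 'p, 'v) fm \<Rightarrow> bool" where
  "wf_fm A \<longleftrightarrow> loose A = {} \<and> nonvacuous A"

text \<open>
  If \<open>Forall A\<close> (or \<open>Exists A\<close>) is the formula \<open>\<forall>x A\<close> (or \<open>\<exists>x A\<close>), then \<open>inst 0 t A\<close> is \<open>A[t/x]\<close>.
  It is only applied to well-formed \<open>t\<close>, so no shifting is needed and no capture can occur.
\<close>

fun inst_tm :: "nat \<Rightarrow> ('f, 'v) tm \<Rightarrow> ('f, 'v) tm \<Rightarrow> ('f, 'v) tm" where
  "inst_tm k u (Var a) = Var a"
| "inst_tm k u (Bnd i) = (if i = k then u else Bnd i)"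
| "inst_tm k u (Fn f ts) = Fn f (map (inst_tm k u) ts)"

fun inst :: "nat \<Rightarrow> ('f, 'v) tm \<Rightarrow> ('f, 'p, 'v) fm \<Rightarrow> ('f, 'p, 'v) fm" where
  "inst k u (Lit b P ts) = Lit b P (map (inst_tm k u) ts)"
| "inst k u (And A B) = And (inst k u A) (inst k u B)"
| "inst k u (Or A B) = Or (inst k u A) (inst k u B)"
| "inst k u (Forall A) = Forall (inst (Suc k) u A)"
| "inst k u (Exists A) = Exists (inst (Suc k) u A)"

fun dual :: "('f, 'p, 'v) fm \<Rightarrow> ('f, 'p, 'v) fm" where
  "dual (Lit b P ts) = Lit (\<not> b) P ts"
| "dual (And A B) = Or (dual A) (dual B)"
| "dual (Or A B) = And (dual A) (dual B)"
| "dual (Forall A) = Exists (dual A)"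
| "dual (Exists A) = Forall (dual A)"

fun positive :: "('f, 'p, 'v) fm \<Rightarrow> bool" where
  "positive (Lit b P ts) \<longleftrightarrow> b"
| "positive (And A B) \<longleftrightarrow> False"
| "positive (Or A B) \<longleftrightarrow> True"
| "positive (Forall A) \<longleftrightarrow> False"
| "positive (Exists A) \<longleftrightarrow> True"

lemma positive_dual: "positive (dual A) \<longleftrightarrow> \<not> positive A"
  by (cases A) auto


section \<open>The sequent calculus LK\<close>

text \<open>
  \<open>LK c \<Gamma>\<close>: the finite set \<open>\<Gamma>\<close> has an LK-proof, in which the cut rule may be used iff \<open>c\<close> holds.
  In the rule for \<open>\<exists>\<close>, the requirement that \<open>t\<close> contains no variable bound in \<open>A\<close> becomes
  \<open>wf_tm t\<close>.
\<close>

inductive LK :: "bool \<Rightarrow> ('f, 'p, 'v) fm set \<Rightarrow> bool" for c :: bool where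
  Init: "finite \<Gamma> \<Longrightarrow> \<forall>B\<in>\<Gamma>. wf_fm B \<Longrightarrow> A = Lit True P ts \<Longrightarrow> wf_fm A \<Longrightarrow>
         LK c (insert A (insert (dual A) \<Gamma>))"
| All: "LK c (insert (inst 0 (Var \<alpha>) A) \<Gamma>) \<Longrightarrow> wf_fm (Forall A) \<Longrightarrow>
        \<alpha> \<notin> fv (Forall A) \<Longrightarrow> \<forall>B\<in>\<Gamma>. \<alpha> \<notin> fv B \<Longrightarrow>
        LK c (insert (Forall A) \<Gamma>)"
| Ex: "LK c (insert (inst 0 t A) (insert (Exists A) \<Gamma>)) \<Longrightarrow> wf_tm t \<Longrightarrow>
       LK c (insert (Exists A) \<Gamma>)"
| Conj: "LK c (insert A \<Gamma>) \<Longrightarrow> LK c (insert B \<Gamma>) \<Longrightarrow> LK c (insert (And A B) \<Gamma>)"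
| Disj: "LK c (insert A (insert B \<Gamma>)) \<Longrightarrow> LK c (insert (Or A B) \<Gamma>)"
| Cut: "c \<Longrightarrow> LK c (insert A \<Gamma>) \<Longrightarrow> LK c (insert (dual A) \<Gamma>) \<Longrightarrow> LK c \<Gamma>"

definition LK_provable :: "('f, 'p, 'v) fm set \<Rightarrow> bool" where
  "LK_provable \<Gamma> \<longleftrightarrow> LK True \<Gamma>"

definition LK_cutfree_provable :: "('f, 'p, 'v) fm set \<Rightarrow> bool" where
  "LK_cutfree_provable \<Gamma> \<longleftrightarrow> LK False \<Gamma>"

lemma LK_wf: "LK c \<Gamma> \<Longrightarrow> finite \<Gamma> \<and> (\<forall>A\<in>\<Gamma>. wf_fm A)"
  by (induction rule: LK.induct) (auto simp: wf_fm_def)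


section \<open>Expansion trees\<close>

text \<open>
  \<open>EEx A [(t\<^sub>1, E\<^sub>1), \<dots>, (t\<^sub>n, E\<^sub>n)]\<close> is \<open>\<exists>x A +\<^bsup>t\<^sub>1\<^esup> E\<^sub>1 \<dots> +\<^bsup>t\<^sub>n\<^esup> E\<^sub>n\<close>, where \<open>n = 0\<close> is
  permitted; \<open>EAll A \<alpha> E\<close> is \<open>\<forall>x A +\<^bsup>\<alpha>\<^esup> E\<close>.
\<close>

datatype ('f, 'p, 'v) etree =
    ELit bool 'p "('f, 'v) tm list"
  | EAnd "('f, 'p, 'v) etree" "('f, 'p, 'v) etree"
  | EOr "('f, 'p, 'v) etree" "('f, 'p, 'v) etree"
  | EEx "('f, 'p, 'v) fm" "(('f, 'v) tm \<times> ('f, 'p, 'v) etree) list"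
  | EAll "('f, 'p, 'v) fm" 'v "('f, 'p, 'v) etree"

fun Sh :: "('f, 'p, 'v) etree \<Rightarrow> ('f, 'p, 'v) fm" where
  "Sh (ELit b P ts) = Lit b P ts"
| "Sh (EAnd E1 E2) = And (Sh E1) (Sh E2)"
| "Sh (EOr E1 E2) = Or (Sh E1) (Sh E2)"
| "Sh (EEx A tEs) = Exists A"
| "Sh (EAll A \<alpha> E) = Forall A"

inductive expansion_tree :: "('f, 'p, 'v) etree \<Rightarrow> bool" where
  "wf_fm (Lit b P ts) \<Longrightarrow> expansion_tree (ELit b P ts)"
| "expansion_tree E1 \<Longrightarrow> expansion_tree E2 \<Longrightarrow> expansion_tree (EAnd E1 E2)"
| "expansion_tree E1 \<Longrightarrow> expansion_tree E2 \<Longrightarrow> expansion_tree (EOr E1 E2)"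
| "wf_fm (Exists A) \<Longrightarrow>
   (\<And>t E. (t, E) \<in> set tEs \<Longrightarrow> wf_tm t \<and> expansion_tree E \<and> Sh E = inst 0 t A) \<Longrightarrow>
   expansion_tree (EEx A tEs)"
| "wf_fm (Forall A) \<Longrightarrow> expansion_tree E \<Longrightarrow> Sh E = inst 0 (Var \<alpha>) A \<Longrightarrow>
   expansion_tree (EAll A \<alpha> E)"

lemma wf_fm_Sh: "expansion_tree E \<Longrightarrow> wf_fm (Sh E)"
  by (induction rule: expansion_tree.induct) (auto simp: wf_fm_def)

text \<open>
  Deep formulas are quantifier-free, but contain \<open>n\<close>-ary disjunctions, with the empty one being
  false.
\<close>

datatype ('f, 'p, 'v) qf =
    QLit bool 'p "('f, 'v) tm list"
  | QAnd "('f, 'p, 'v) qf" "('f, 'p, 'v) qf"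
  | QOr "('f, 'p, 'v) qf" "('f, 'p, 'v) qf"
  | QBigOr "('f, 'p, 'v) qf list"

fun holds :: "('p \<Rightarrow> ('f, 'v) tm list \<Rightarrow> bool) \<Rightarrow> ('f, 'p, 'v) qf \<Rightarrow> bool" where
  "holds I (QLit b P ts) \<longleftrightarrow> (if b then I P ts else \<not> I P ts)"
| "holds I (QAnd D1 D2) \<longleftrightarrow> holds I D1 \<and> holds I D2"
| "holds I (QOr D1 D2) \<longleftrightarrow> holds I D1 \<or> holds I D2"
| "holds I (QBigOr Ds) \<longleftrightarrow> (\<exists>D\<in>set Ds. holds I D)"

fun Dp :: "('f, 'p, 'v) etree \<Rightarrow> ('f, 'p, 'v) qf" where
  "Dp (ELit b P ts) = QLit b P ts"
| "Dp (EAnd E1 E2) = QAnd (Dp E1) (Dp E2)"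
| "Dp (EOr E1 E2) = QOr (Dp E1) (Dp E2)"
| "Dp (EEx A tEs) = QBigOr (map (\<lambda>(t, E). Dp E) tEs)"
| "Dp (EAll A \<alpha> E) = Dp E"

text \<open>Branches are lists of formulas (\<open>Inl\<close>) and integers (\<open>Inr\<close>).\<close>

fun Br :: "('f, 'p, 'v) etree \<Rightarrow> (('f, 'p, 'v) fm + nat) list set" where
  "Br (ELit b P ts) = {[Inl (Lit b P ts)]}"
| "Br (EAnd E1 E2) =
     {Inl (Sh (EAnd E1 E2)) # Inr i # s | i s. (i = 1 \<and> s \<in> Br E1) \<or> (i = 2 \<and> s \<in> Br E2)}"
| "Br (EOr E1 E2) =
     {Inl (Sh (EOr E1 E2)) # Inr i # s | i s. (i = 1 \<and> s \<in> Br E1) \<or> (i = 2 \<and> s \<in> Br E2)}"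
| "Br (EEx A tEs) = {Inl (Exists A) # s | s. s \<in> (\<Union>(t, E)\<in>set tEs. Br E)}"
| "Br (EAll A \<alpha> E) = {Inl (Forall A) # s | s. s \<in> Br E}"


section \<open>Cuts\<close>

text \<open>
  A cut is written as the pair \<open>(E1, E2)\<close> in which \<open>Sh E1\<close> is positive. By \<open>positive_dual\<close>,
  exactly one of the two orderings of a cut has this property.
\<close>

type_synonym ('f, 'p, 'v) cut = "('f, 'p, 'v) etree \<times> ('f, 'p, 'v) etree"

definition is_cut :: "('f, 'p, 'v) cut \<Rightarrow> bool" where
  "is_cut C \<longleftrightarrow> expansion_tree (fst C) \<and> expansion_tree (snd C) \<and>
     Sh (fst C) = dual (Sh (snd C)) \<and> positive (Sh (fst C))"

definition Sh_cut :: "('f, 'p, 'v) cut \<Rightarrow> ('f, 'p, 'v) fm" where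
  "Sh_cut C = Sh (fst C)"

definition Dp_cut :: "('f, 'p, 'v) cut \<Rightarrow> ('f, 'p, 'v) qf" where
  "Dp_cut C = QAnd (Dp (fst C)) (Dp (snd C))"

definition Br_cut :: "('f, 'p, 'v) cut \<Rightarrow> (('f, 'p, 'v) fm + nat) list set" where
  "Br_cut C = Br (fst C) \<union> Br (snd C)"


section \<open>Occurrences of expansions and the dependency relation\<close>

datatype ('f, 'v) expansion = ExExp "('f, 'v) tm" | AllExp 'v

text \<open>
  \<open>(p, x) \<in> exps E\<close>: an expansion \<open>x\<close> occurs in \<open>E\<close> at the edge reached from the root by the
  path \<open>p\<close>. The last step of \<open>p\<close> is the edge of \<open>x\<close> itself, so an expansion dominates
  another one of the same tree iff its path is a strict prefix of the path of the other.
\<close>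

fun exps :: "('f, 'p, 'v) etree \<Rightarrow> (nat list \<times> ('f, 'v) expansion) set" where
  "exps (ELit b P ts) = {}"
| "exps (EAnd E1 E2) =
     {(1 # p, x) | p x. (p, x) \<in> exps E1} \<union> {(2 # p, x) | p x. (p, x) \<in> exps E2}"
| "exps (EOr E1 E2) =
     {(1 # p, x) | p x. (p, x) \<in> exps E1} \<union> {(2 # p, x) | p x. (p, x) \<in> exps E2}"
| "exps (EEx A tEs) =
     {([i], ExExp (fst (tEs ! i))) | i. i < length tEs} \<union>
     {(i # p, x) | i p x. i < length tEs \<and> (p, x) \<in> map (\<lambda>(t, E). exps E) tEs ! i}"
| "exps (EAll A \<alpha> E) = {([0], AllExp \<alpha>)} \<union> {(0 # p, x) | p x. (p, x) \<in> exps E}"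

text \<open>
  A pair of cuts and expansion trees. The lists stand for sequences modulo permutation:
  everything defined below is invariant under reordering.
\<close>

type_synonym ('f, 'p, 'v) eproof = "('f, 'p, 'v) cut list \<times> ('f, 'p, 'v) etree list"

text \<open>The trees in the left and right parts of the \<open>i\<close>-th cut, and the \<open>i\<close>-th tree.\<close>

datatype place = CutL nat | CutR nat | InTree nat

fun tree_at :: "('f, 'p, 'v) eproof \<Rightarrow> place \<Rightarrow> ('f, 'p, 'v) etree \<Rightarrow> bool" where
  "tree_at (Cs, Es) (CutL i) E \<longleftrightarrow> i < length Cs \<and> E = fst (Cs ! i)"
| "tree_at (Cs, Es) (CutR i) E \<longleftrightarrow> i < length Cs \<and> E = snd (Cs ! i)"
| "tree_at (Cs, Es) (InTree i) E \<longleftrightarrow> i < length Es \<and> E = Es ! i"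

definition expansion_at ::
  "('f, 'p, 'v) eproof \<Rightarrow> place \<Rightarrow> nat list \<Rightarrow> ('f, 'v) expansion \<Rightarrow> bool" where
  "expansion_at \<P> l p x \<longleftrightarrow> (\<exists>E. tree_at \<P> l E \<and> (p, x) \<in> exps E)"

datatype occurrence = CutOcc nat | ExpOcc place "nat list"

inductive dep0 :: "('f, 'p, 'v) eproof \<Rightarrow> occurrence \<Rightarrow> occurrence \<Rightarrow> bool"
  for \<P> :: "('f, 'p, 'v) eproof" where
  eigen_term: "expansion_at \<P> l p (AllExp \<alpha>) \<Longrightarrow> expansion_at \<P> l' p' (ExExp t) \<Longrightarrow>
     \<alpha> \<in> fv_tm t \<Longrightarrow> dep0 \<P> (ExpOcc l p) (ExpOcc l' p')"
| dominates: "expansion_at \<P> l p x \<Longrightarrow> expansion_at \<P> l p' x' \<Longrightarrow> strict_prefix p p' \<Longrightarrow>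
     dep0 \<P> (ExpOcc l p) (ExpOcc l p')"
| cut_exp: "expansion_at \<P> l p x \<Longrightarrow> l = CutL i \<or> l = CutR i \<Longrightarrow>
     dep0 \<P> (CutOcc i) (ExpOcc l p)"
| eigen_cut: "expansion_at \<P> l p (AllExp \<alpha>) \<Longrightarrow> i < length (fst \<P>) \<Longrightarrow>
     \<alpha> \<in> fv (Sh_cut (fst \<P> ! i)) \<Longrightarrow> dep0 \<P> (ExpOcc l p) (CutOcc i)"

definition dep :: "('f, 'p, 'v) eproof \<Rightarrow> occurrence \<Rightarrow> occurrence \<Rightarrow> bool" where
  "dep \<P> = (dep0 \<P>)\<^sup>+\<^sup>+"


section \<open>Expansion proofs\<close>

text \<open>\<open>Inl\<close> marks a cut and \<open>Inr\<close> a tree.\<close>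

definition elements ::
  "('f, 'p, 'v) eproof \<Rightarrow> (('f, 'p, 'v) cut + ('f, 'p, 'v) etree) set" where
  "elements \<P> = Inl ` set (fst \<P>) \<union> Inr ` set (snd \<P>)"

definition Br_element ::
  "('f, 'p, 'v) cut + ('f, 'p, 'v) etree \<Rightarrow> (('f, 'p, 'v) fm + nat) list set" where
  "Br_element = case_sum Br_cut Br"

definition weakly_regular :: "('f, 'p, 'v) eproof \<Rightarrow> bool" where
  "weakly_regular \<P> \<longleftrightarrow>
     (\<forall>S\<in>elements \<P>. \<forall>T\<in>elements \<P>. \<forall>s s' r r' A B \<alpha>.
        s @ [Inl (Forall A), Inl (inst 0 (Var \<alpha>) A)] @ s' \<in> Br_element T \<longrightarrow>
        r @ [Inl (Forall B), Inl (inst 0 (Var \<alpha>) B)] @ r' \<in> Br_element S \<longrightarrow>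
        s = r \<and> A = B \<and> (isl S \<longleftrightarrow> isl T))"

definition Sh_proof :: "('f, 'p, 'v) eproof \<Rightarrow> ('f, 'p, 'v) fm set" where
  "Sh_proof \<P> = Sh ` set (snd \<P>)"

definition Dp_proof :: "('f, 'p, 'v) eproof \<Rightarrow> ('f, 'p, 'v) qf set" where
  "Dp_proof \<P> = Dp ` set (snd \<P>) \<union> Dp_cut ` set (fst \<P>)"

definition tautology :: "('f, 'p, 'v) qf set \<Rightarrow> bool" where
  "tautology \<Delta> \<longleftrightarrow> (\<forall>I. \<exists>D\<in>\<Delta>. holds I D)"

definition eigenvariable_condition :: "('f, 'p, 'v) eproof \<Rightarrow> bool" where
  "eigenvariable_condition \<P> \<longleftrightarrow>
     (\<forall>l p \<alpha>. expansion_at \<P> l p (AllExp \<alpha>) \<longrightarrow> (\<forall>A\<in>Sh_proof \<P>. \<alpha> \<notin> fv A))"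

definition expansion_proof :: "('f, 'p, 'v) eproof \<Rightarrow> bool" where
  "expansion_proof \<P> \<longleftrightarrow>
     (\<forall>C\<in>set (fst \<P>). is_cut C) \<and> (\<forall>E\<in>set (snd \<P>). expansion_tree E) \<and>
     weakly_regular \<P> \<and>
     (\<nexists>v. dep \<P> v v) \<and>
     tautology (Dp_proof \<P>) \<and>
     eigenvariable_condition \<P>"

definition cut_free :: "('f, 'p, 'v) eproof \<Rightarrow> bool" where
  "cut_free \<P> \<longleftrightarrow> fst \<P> = []"

end

theory Submission
  imports Defs
begin

text \<open>
  An LK-proof is built from its end-sequent upwards. A stage of the construction is a sequent
  together with expansion trees for some of its formulas and the cuts that have not been used yet,
  such that the deep formulas of these trees and cuts still form a tautology. A tree for a
  conjunction or disjunction is replaced by its immediate subtrees; an \<open>\<exists>\<close>-expansion or a cut is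
  used as soon as its term or cut formula contains no eigenvariable of an expansion that is still to
  come. Otherwise a \<open>\<forall>\<close>-expansion has to be opened, and its eigenvariable must be fresh.

  Several trees may share an eigenvariable \<open>\<alpha>\<close>, so all expansions \<open>+\<^sup>\<alpha>\<close> have to be opened by a
  single inference. This is possible when all of them are at the roots of their trees and carry the
  same formula. The second point is weak regularity. For the first point, say that \<open>\<beta>\<close> precedes
  \<open>\<alpha>\<close> if some \<open>+\<^sup>\<alpha>\<close> is dominated by \<open>+\<^sup>\<beta>\<close> or by an \<open>\<exists>\<close>-expansion whose term contains \<open>\<beta>\<close>, or
  belongs to a cut whose formula contains \<open>\<beta>\<close>. If this relation on variables is well-founded, take
  a minimal \<open>\<alpha>\<close> among those still to come: whatever lies above some \<open>+\<^sup>\<alpha>\<close> would involve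
  an eigenvariable that is still to come and precedes \<open>\<alpha>\<close>, hence nothing lies above it.
  When no eigenvariable is left, the construction ends with a tautology among literals. This is \<open>LK_of_derivation_state\<close>.

  It remains to see why the relation is well-founded (\<open>wf_eigen_order\<close>). Acyclicity is a property of
  occurrences, whereas the relation is between variables: in a chain \<open>\<gamma>\<close>, \<open>\<beta>\<close>, \<open>\<alpha>\<close> the two
  links may involve different occurrences of \<open>+\<^sup>\<beta>\<close>. However, what precedes \<open>\<beta>\<close> can be read off the
  part of a branch that leads to \<open>+\<^sup>\<beta>\<close>, and by weak regularity this part is the same for all
  occurrences. So a descending chain of variables lifts to a descending chain of occurrences, of
  which there are only finitely many.

  Subtrees without branches (those in which every path ends in an \<open>\<exists>\<close>-node without expansions) need
  care, because weak regularity does not constrain the eigenvariables in them. Their deep formulas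
  are unsatisfiable, so they never have to be opened. Hence only the \<^emph>\<open>live\<close> \<open>\<forall>\<close>-expansions are
  taken into account, that is, those above a subtree that has a branch.
\<close>

section \<open>Instantiation, branches and deep formulas\<close>

lemma inst_tm_inject:
  "inst_tm k u s = inst_tm k u' s \<Longrightarrow> k \<in> loose_tm s \<Longrightarrow> u = u'"
  by (induction s) auto

text \<open>
  As quantifiers are not vacuous, an instance of the matrix determines the term. This is what makes
  it possible to recover the term or eigenvariable of an expansion from a branch.
\<close>

lemma inst_inject: "inst k u A = inst k u' A \<Longrightarrow> k \<in> loose A \<Longrightarrow> u = u'"
  by (induction A arbitrary: k) (auto dest: inst_tm_inject)

lemma fv_inst_tm: "fv_tm (inst_tm k u s) \<subseteq> fv_tm s \<union> fv_tm u"
  by (induction s) auto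

lemma fv_inst: "fv (inst k u A) \<subseteq> fv A \<union> fv_tm u"
proof (induction A arbitrary: k)
  case (Lit b P ts)
  then show ?case using fv_inst_tm by fastforce
qed fastforce+

lemma fv_dual: "fv (dual A) = fv A"
  by (induction A) auto

lemma Br_starts_with_Sh: "br \<in> Br E \<Longrightarrow> \<exists>r. br = Inl (Sh E) # r"
  by (cases E) auto

lemma Br_empty_imp_not_holds: "Br E = {} \<Longrightarrow> \<not> holds I (Dp E)"
proof (induction E)
  case (EEx A tEs)
  show ?case
  proof
    assume "holds I (Dp (EEx A tEs))"
    then obtain t E where tE: "(t, E) \<in> set tEs" "holds I (Dp E)" by auto
    have "Br E = {}"
    proof (rule ccontr)
      assume "Br E \<noteq> {}"
      then obtain s where "s \<in> Br E" by auto
      with tE have "Inl (Exists A) # s \<in> Br (EEx A tEs)" by auto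
      with EEx.prems show False by blast
    qed
    with EEx.IH[OF tE(1), of E] tE(2) show False by simp
  qed
qed auto

section \<open>Live eigenvariables and their ordering\<close>

text \<open>
  Each live eigenvariable is paired with the matrix of the quantifier that it instantiates. Only
  the last clause has to test for liveness: a subtree with a live expansion has a branch.
\<close>

fun live_eigs :: "('f, 'p, 'v) etree \<Rightarrow> ('v \<times> ('f, 'p, 'v) fm) set" where
  "live_eigs (ELit b P ts) = {}"
| "live_eigs (EAnd E1 E2) = live_eigs E1 \<union> live_eigs E2"
| "live_eigs (EOr E1 E2) = live_eigs E1 \<union> live_eigs E2"
| "live_eigs (EEx A tEs) = (\<Union>(t, E)\<in>set tEs. live_eigs E)"
| "live_eigs (EAll A \<alpha> E) = (if Br E = {} then {} else insert (\<alpha>, A) (live_eigs E))"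

definition live_eigs_cut :: "('f, 'p, 'v) cut \<Rightarrow> ('v \<times> ('f, 'p, 'v) fm) set" where
  "live_eigs_cut C = live_eigs (fst C) \<union> live_eigs (snd C)"

definition remaining_eigs ::
  "('f, 'p, 'v) cut list \<Rightarrow> ('f, 'p, 'v) etree list \<Rightarrow> ('v \<times> ('f, 'p, 'v) fm) set" where
  "remaining_eigs Cs Es = (\<Union>C\<in>set Cs. live_eigs_cut C) \<union> (\<Union>E\<in>set Es. live_eigs E)"

text \<open>
  The precedence that a tree imposes on variables: a live \<open>\<forall>\<close>-expansion waits for all variables,
  whether eigenvariables or not, in the terms and eigenvariables of the expansions above it.
\<close>

fun ordered_by :: "('v \<times> 'v) set \<Rightarrow> ('f, 'p, 'v) etree \<Rightarrow> bool" where
  "ordered_by R (ELit b P ts) \<longleftrightarrow> True"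
| "ordered_by R (EAnd E1 E2) \<longleftrightarrow> ordered_by R E1 \<and> ordered_by R E2"
| "ordered_by R (EOr E1 E2) \<longleftrightarrow> ordered_by R E1 \<and> ordered_by R E2"
| "ordered_by R (EEx A tEs) \<longleftrightarrow> (\<forall>(t, E)\<in>set tEs. ordered_by R E \<and> fv_tm t \<times> fst ` live_eigs E \<subseteq> R)"
| "ordered_by R (EAll A \<alpha> E) \<longleftrightarrow> ordered_by R E \<and> {\<alpha>} \<times> fst ` live_eigs E \<subseteq> R"

definition ordered_cut :: "('v \<times> 'v) set \<Rightarrow> ('f, 'p, 'v) cut \<Rightarrow> bool" where
  "ordered_cut R C \<longleftrightarrow> ordered_by R (fst C) \<and> ordered_by R (snd C) \<and>
     fv (Sh_cut C) \<times> fst ` live_eigs_cut C \<subseteq> R"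

section \<open>Construction of LK-proofs\<close>

text \<open>
  The stages of the construction. \<open>\<Gamma>\<close> may contain formulas without a tree, because principal
  formulas are kept. Single-valuedness says that live expansions with the same eigenvariable
  instantiate the same formula.
\<close>

definition derivation_state :: "('v \<times> 'v) set \<Rightarrow> ('f, 'p, 'v) fm set \<Rightarrow>
    ('f, 'p, 'v) cut list \<Rightarrow> ('f, 'p, 'v) etree list \<Rightarrow> bool" where
  "derivation_state R \<Gamma> Cs Es \<longleftrightarrow>
     finite \<Gamma> \<and> (\<forall>A\<in>\<Gamma>. wf_fm A) \<and>
     (\<forall>E\<in>set Es. Sh E \<in> \<Gamma> \<and> expansion_tree E \<and> ordered_by R E) \<and>
     (\<forall>C\<in>set Cs. is_cut C \<and> ordered_cut R C) \<and>
     single_valued (remaining_eigs Cs Es) \<and>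
     (\<forall>\<alpha>\<in>fst ` remaining_eigs Cs Es. \<forall>A\<in>\<Gamma>. \<alpha> \<notin> fv A) \<and>
     tautology (Dp_proof (Cs, Es))"

text \<open>
  The successor in the sum is the weight of an \<open>\<exists>\<close>-expansion: using it moves its subtree out of the
  tree, and this has to decrease the total size.
\<close>

fun nodes :: "('f, 'p, 'v) etree \<Rightarrow> nat" where
  "nodes (ELit b P ts) = 1"
| "nodes (EAnd E1 E2) = Suc (nodes E1 + nodes E2)"
| "nodes (EOr E1 E2) = Suc (nodes E1 + nodes E2)"
| "nodes (EEx A tEs) = Suc (\<Sum>(t, E)\<leftarrow>tEs. Suc (nodes E))"
| "nodes (EAll A \<alpha> E) = Suc (nodes E)"

definition state_size :: "('f, 'p, 'v) cut list \<Rightarrow> ('f, 'p, 'v) etree list \<Rightarrow> nat" where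
  "state_size Cs Es =
     (\<Sum>C\<leftarrow>Cs. Suc (nodes (fst C) + nodes (snd C))) + (\<Sum>E\<leftarrow>Es. nodes E)"

text \<open>
  The part of the invariant that is common to the inferences with a single new formula \<open>A\<close>. As the
  eigenvariables still to come only become fewer, single-valuedness is inherited, and freshness has
  to be checked for \<open>A\<close> only.
\<close>

lemma derivation_state_step:
  assumes "derivation_state R \<Gamma> Cs Es"
    and "wf_fm A"
    and "\<And>\<alpha>. \<alpha> \<in> fv A \<Longrightarrow> \<alpha> \<notin> fst ` remaining_eigs Cs' Es'"
    and "set Cs' \<subseteq> set Cs"
    and "\<And>E. E \<in> set Es' \<Longrightarrow> Sh E \<in> insert A \<Gamma> \<and> expansion_tree E \<and> ordered_by R E"
    and "remaining_eigs Cs' Es' \<subseteq> remaining_eigs Cs Es"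
    and "\<And>I D. D \<in> Dp_proof (Cs, Es) \<Longrightarrow> holds I D \<Longrightarrow> \<exists>D'\<in>Dp_proof (Cs', Es'). holds I D'"
  shows "derivation_state R (insert A \<Gamma>) Cs' Es'"
proof -
  have "single_valued (remaining_eigs Cs' Es')"
    using assms(1,6) by (auto simp: derivation_state_def intro: single_valued_subset)
  moreover have "\<alpha> \<notin> fv B" if "\<alpha> \<in> fst ` remaining_eigs Cs' Es'" "B \<in> insert A \<Gamma>" for \<alpha> B
    using that assms(1,3,6) unfolding derivation_state_def by blast
  moreover have "tautology (Dp_proof (Cs', Es'))"
    using assms(1,7) unfolding derivation_state_def tautology_def by meson
  ultimately show ?thesis
    using assms(1,2,4,5) unfolding derivation_state_def by auto
qed

text \<open>
  If only literals can contribute to the tautology, the interpretation that makes exactly those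
  atoms false that occur as trees can only satisfy a negated atom, whose atom then occurs as well.
\<close>

lemma Init_of_literal_trees:
  assumes st: "derivation_state R \<Gamma> [] Es"
    and lits: "\<And>E I. E \<in> set Es \<Longrightarrow> holds I (Dp E) \<Longrightarrow> \<exists>b P ts. E = ELit b P ts"
  shows "LK c \<Gamma>"
proof -
  define I where "I = (\<lambda>P ts. ELit True P ts \<notin> set Es)"
  have "\<exists>D\<in>Dp_proof ([], Es). holds I D"
    using st unfolding derivation_state_def tautology_def by blast
  then obtain E where E: "E \<in> set Es" "holds I (Dp E)"
    by (auto simp: Dp_proof_def)
  then obtain b P ts where "E = ELit b P ts" using lits by blast
  with E have "ELit False P ts \<in> set Es" "ELit True P ts \<in> set Es"
    by (cases b; simp add: I_def)+
  then have mem: "Lit True P ts \<in> \<Gamma>" "dual (Lit True P ts) \<in> \<Gamma>"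
    using st by (force simp: derivation_state_def)+
  then have "LK c (insert (Lit True P ts) (insert (dual (Lit True P ts)) \<Gamma>))"
    using st by (intro LK.Init[OF _ _ refl]) (auto simp: derivation_state_def)
  with mem show ?thesis by (simp add: insert_absorb)
qed

text \<open>
  Roots without branches are left alone: their eigenvariable may be the same while their formula is
  not the one that is instantiated.
\<close>

fun strip_Forall :: "'v \<Rightarrow> ('f, 'p, 'v) etree \<Rightarrow> ('f, 'p, 'v) etree" where
  "strip_Forall \<alpha> (EAll A \<beta> E) = (if \<beta> = \<alpha> \<and> Br E \<noteq> {} then E else EAll A \<beta> E)"
| "strip_Forall \<alpha> E = E"

lemma strip_Forall_cases:
  "strip_Forall \<alpha> E = E \<or> (\<exists>A E'. E = EAll A \<alpha> E' \<and> Br E' \<noteq> {} \<and> strip_Forall \<alpha> E = E')"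
  by (cases E) auto

lemma nodes_strip_Forall: "nodes (strip_Forall \<alpha> E) \<le> nodes E"
  by (cases E) auto

lemma Dp_strip_Forall: "Dp (strip_Forall \<alpha> E) = Dp E"
  by (cases E) auto

lemma live_eigs_strip_Forall: "live_eigs (strip_Forall \<alpha> E) \<subseteq> live_eigs E"
  by (cases E) auto

text \<open>
  The first four cases are inferences whose result is a stage again because their new formulas
  contain no eigenvariable that is still to come. In the last case, if there is any eigenvariable
  left, an \<open>R\<close>-minimal one is opened in all trees at once; otherwise only literals matter.
\<close>

lemma LK_of_derivation_state:
  assumes "wf R" and "derivation_state R \<Gamma> Cs Es" and "Cs \<noteq> [] \<Longrightarrow> c"
  shows "LK c \<Gamma>"
  using assms(2,3)
proof (induction "state_size Cs Es" arbitrary: \<Gamma> Cs Es rule: less_induct)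
  case less
  note st = less.prems(1)
  have wf_tree: "Sh E \<in> \<Gamma>" "expansion_tree E" "ordered_by R E" if "E \<in> set Es" for E
    using st that by (auto simp: derivation_state_def)
  let ?W = "fst ` remaining_eigs Cs Es"
  have fresh: "\<alpha> \<notin> fv A" if "\<alpha> \<in> ?W" "A \<in> \<Gamma>" for \<alpha> A
    using st that by (auto simp: derivation_state_def)
  consider
      (conj) E1 E2 where "EAnd E1 E2 \<in> set Es"
    | (disj) E1 E2 where "EOr E1 E2 \<in> set Es"
    | (ex) A tEs t E where "EEx A tEs \<in> set Es" "(t, E) \<in> set tEs" "fv_tm t \<inter> ?W = {}"
    | (cut) C where "C \<in> set Cs" "fv (Sh_cut C) \<inter> ?W = {}"
    | (blocked) "\<nexists>E1 E2. EAnd E1 E2 \<in> set Es" "\<nexists>E1 E2. EOr E1 E2 \<in> set Es"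
        "\<nexists>A tEs t E. EEx A tEs \<in> set Es \<and> (t, E) \<in> set tEs \<and> fv_tm t \<inter> ?W = {}"
        "\<nexists>C. C \<in> set Cs \<and> fv (Sh_cut C) \<inter> ?W = {}"
    by metis
  then show ?case
  proof cases
    case conj
    then obtain xs ys where Es: "Es = xs @ EAnd E1 E2 # ys" by (meson split_list)
    have E: "Sh (EAnd E1 E2) \<in> \<Gamma>" "expansion_tree E1" "expansion_tree E2"
        "ordered_by R E1" "ordered_by R E2"
      using wf_tree[OF conj] by (auto elim: expansion_tree.cases)
    have part: "LK c (insert (Sh E') \<Gamma>)" if E': "E' \<in> {E1, E2}" for E'
    proof (rule less.hyps)
      show "state_size Cs (xs @ E' # ys) < state_size Cs Es"
        using E' by (auto simp: state_size_def Es)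
      have rem: "remaining_eigs Cs (xs @ E' # ys) \<subseteq> remaining_eigs Cs Es"
        using E' by (auto simp: remaining_eigs_def Es)
      show "derivation_state R (insert (Sh E') \<Gamma>) Cs (xs @ E' # ys)"
      proof (rule derivation_state_step[OF st _ _ _ _ rem])
        show "\<And>\<alpha>. \<alpha> \<in> fv (Sh E') \<Longrightarrow> \<alpha> \<notin> fst ` remaining_eigs Cs (xs @ E' # ys)"
          using fresh[OF _ E(1)] E' rem by auto
        show "\<And>I D. D \<in> Dp_proof (Cs, Es) \<Longrightarrow> holds I D \<Longrightarrow>
            \<exists>D'\<in>Dp_proof (Cs, xs @ E' # ys). holds I D'"
          using E' by (auto simp: Dp_proof_def Es)
      qed (use E E' wf_tree wf_fm_Sh in \<open>auto simp: Es\<close>)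
    qed (use less.prems in auto)
    have "LK c (insert (And (Sh E1) (Sh E2)) \<Gamma>)"
      by (intro LK.Conj part) auto
    with E(1) show ?thesis by (simp add: insert_absorb)
  next
    case disj
    then obtain xs ys where Es: "Es = xs @ EOr E1 E2 # ys" by (meson split_list)
    have E: "Sh (EOr E1 E2) \<in> \<Gamma>" "expansion_tree E1" "expansion_tree E2"
        "ordered_by R E1" "ordered_by R E2"
      using wf_tree[OF disj] by (auto elim: expansion_tree.cases)
    define Es' where "Es' = xs @ E1 # E2 # ys"
    have rem: "remaining_eigs Cs Es' = remaining_eigs Cs Es"
      by (auto simp: remaining_eigs_def Es Es'_def)
    have "LK c (insert (Sh E1) (insert (Sh E2) \<Gamma>))"
    proof (rule less.hyps)
      show "state_size Cs Es' < state_size Cs Es"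
        by (auto simp: state_size_def Es Es'_def)
      have "fv (Sh E1) \<inter> ?W = {}" "fv (Sh E2) \<inter> ?W = {}" "wf_fm (Sh E1)" "wf_fm (Sh E2)"
        using fresh[OF _ E(1)] E wf_fm_Sh by auto
      moreover have "Sh F \<in> insert (Sh E1) (insert (Sh E2) \<Gamma>) \<and> expansion_tree F \<and> ordered_by R F"
        if "F \<in> set Es'" for F
        using that E wf_tree by (auto simp: Es Es'_def)
      moreover have "\<exists>D'\<in>Dp_proof (Cs, Es'). holds I D'" if "D \<in> Dp_proof (Cs, Es)" "holds I D" for I D
        using that by (auto simp: Dp_proof_def Es Es'_def)
      ultimately show "derivation_state R (insert (Sh E1) (insert (Sh E2) \<Gamma>)) Cs Es'"
        using st by (auto simp: derivation_state_def rem tautology_def) meson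
    qed (use less.prems in auto)
    then have "LK c (insert (Or (Sh E1) (Sh E2)) \<Gamma>)" by (rule LK.Disj)
    with E(1) show ?thesis by (simp add: insert_absorb)
  next
    case ex
    obtain xs ys where Es: "Es = xs @ EEx A tEs # ys" using ex(1) by (meson split_list)
    have mem: "Exists A \<in> \<Gamma>" using wf_tree[OF ex(1)] by auto
    have sub: "set (remove1 (t, E) tEs) \<subseteq> set tEs" by (rule set_remove1_subset)
    have tree: "wf_fm (Exists A)"
        "\<And>u F. (u, F) \<in> set tEs \<Longrightarrow> wf_tm u \<and> expansion_tree F \<and> Sh F = inst 0 u A"
      using wf_tree(2)[OF ex(1)] by (auto elim: expansion_tree.cases)
    have E: "wf_tm t" "expansion_tree E" "Sh E = inst 0 t A" "ordered_by R E"
      using tree(2)[OF ex(2)] wf_tree(3)[OF ex(1)] ex(2) by auto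
    have rest: "expansion_tree (EEx A (remove1 (t, E) tEs))"
        "ordered_by R (EEx A (remove1 (t, E) tEs))"
      using tree sub wf_tree(3)[OF ex(1)] unfolding ordered_by.simps
      by (blast intro: expansion_tree.intros)+
    define Es' where "Es' = xs @ EEx A (remove1 (t, E) tEs) # E # ys"
    have rem: "remaining_eigs Cs Es' \<subseteq> remaining_eigs Cs Es"
      using ex(2) sub by (fastforce simp: remaining_eigs_def Es Es'_def)
    have "LK c (insert (inst 0 t A) \<Gamma>)"
    proof (rule less.hyps)
      show "state_size Cs Es' < state_size Cs Es"
        using sum_list_map_remove1[OF ex(2), of "\<lambda>(t, E). Suc (nodes E)"]
        by (simp add: state_size_def Es Es'_def)
      show "derivation_state R (insert (inst 0 t A) \<Gamma>) Cs Es'"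
      proof (rule derivation_state_step[OF st _ _ _ _ rem])
        show "wf_fm (inst 0 t A)" using wf_fm_Sh[OF E(2)] E(3) by simp
        show "\<alpha> \<notin> fst ` remaining_eigs Cs Es'" if "\<alpha> \<in> fv (inst 0 t A)" for \<alpha>
        proof
          assume "\<alpha> \<in> fst ` remaining_eigs Cs Es'"
          with rem have "\<alpha> \<in> ?W" by auto
          with fresh[OF _ mem] ex(3) that fv_inst[of 0 t A] show False by auto
        qed
        show "\<exists>D'\<in>Dp_proof (Cs, Es'). holds I D'" if "D \<in> Dp_proof (Cs, Es)" "holds I D" for I D
        proof (cases "D = Dp (EEx A tEs)")
          case True
          with that(2) obtain u F where uF: "(u, F) \<in> set tEs" "holds I (Dp F)" by auto
          then consider "F = E" | "(u, F) \<in> set (remove1 (t, E) tEs)"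
            by (metis in_set_remove1 prod.inject)
          then show ?thesis
            using uF(2) by cases (force simp: Dp_proof_def Es'_def)+
        next
          case False
          with that show ?thesis by (auto simp: Dp_proof_def Es Es'_def)
        qed
      qed (use E rest wf_tree mem in \<open>auto simp: Es Es'_def simp del: ordered_by.simps\<close>)
    qed (use less.prems in auto)
    then have "LK c (insert (inst 0 t A) (insert (Exists A) \<Gamma>))"
      using mem by (simp add: insert_absorb)
    then have "LK c (insert (Exists A) \<Gamma>)" using E(1) by (rule LK.Ex)
    with mem show ?thesis by (simp add: insert_absorb)
  next
    case cut
    then obtain xs ys where Cs: "Cs = xs @ C # ys" by (meson split_list)
    have C: "is_cut C" "ordered_cut R C"
      using st cut by (auto simp: derivation_state_def)
    have c: "c" using less.prems(2) Cs by simp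
    have part: "LK c (insert (Sh E) \<Gamma>)" if E: "E \<in> {fst C, snd C}" for E
    proof (rule less.hyps)
      show "state_size (xs @ ys) (E # Es) < state_size Cs Es"
        using E by (auto simp: state_size_def Cs)
      have rem: "remaining_eigs (xs @ ys) (E # Es) \<subseteq> remaining_eigs Cs Es"
        using E by (auto simp: remaining_eigs_def live_eigs_cut_def Cs)
      show "derivation_state R (insert (Sh E) \<Gamma>) (xs @ ys) (E # Es)"
      proof (rule derivation_state_step[OF st _ _ _ _ rem])
        have "fv (Sh E) = fv (Sh_cut C)"
          using E C(1) by (auto simp: is_cut_def Sh_cut_def fv_dual)
        then show "\<And>\<alpha>. \<alpha> \<in> fv (Sh E) \<Longrightarrow> \<alpha> \<notin> fst ` remaining_eigs (xs @ ys) (E # Es)"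
          using cut(2) rem by auto
        show "\<And>I D. D \<in> Dp_proof (Cs, Es) \<Longrightarrow> holds I D \<Longrightarrow>
            \<exists>D'\<in>Dp_proof (xs @ ys, E # Es). holds I D'"
          using E by (auto simp: Dp_proof_def Cs Dp_cut_def)
      qed (use C E wf_tree wf_fm_Sh in \<open>auto simp: Cs is_cut_def ordered_cut_def\<close>)
    qed (rule c)
    note c
    moreover have "LK c (insert (Sh (snd C)) \<Gamma>)" "LK c (insert (dual (Sh (snd C))) \<Gamma>)"
      using part[of "snd C"] part[of "fst C"] C(1) by (auto simp: is_cut_def)
    ultimately show ?thesis by (rule LK.Cut)
  next
    case blocked
    show ?thesis
    proof (cases "?W = {}")
      case True
      have "Cs = []" using blocked(4) True by (cases Cs) auto
      moreover have "\<exists>b P ts. E = ELit b P ts" if "E \<in> set Es" "holds I (Dp E)" for E I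
      proof (cases E)
        case (EEx A tEs)
        with that obtain t F where "(t, F) \<in> set tEs" by auto
        with blocked(3) that(1) EEx True show ?thesis by blast
      next
        case (EAll A \<alpha> F)
        with that(2) have "Br F \<noteq> {}" using Br_empty_imp_not_holds by force
        with that(1) EAll have "(\<alpha>, A) \<in> remaining_eigs Cs Es" by (force simp: remaining_eigs_def)
        with True show ?thesis by auto
      qed (use that blocked(1,2) in auto)
      ultimately show ?thesis using st Init_of_literal_trees by blast
    next
      case False
      then obtain \<alpha> where \<alpha>: "\<alpha> \<in> ?W" "\<And>\<beta>. (\<beta>, \<alpha>) \<in> R \<Longrightarrow> \<beta> \<notin> ?W"
        using wfE_min[OF assms(1)] by (metis ex_in_conv)
      \<comment> \<open>Whatever is above an occurrence of \<open>\<alpha>\<close> is blocked by a remaining \<open>R\<close>-predecessor of \<open>\<alpha>\<close>,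
        so by minimality nothing is above it: it is outside the cuts and at the root of its tree.\<close>
      have no_cut: "\<alpha> \<notin> fst ` live_eigs_cut C" if C: "C \<in> set Cs" for C
      proof
        assume "\<alpha> \<in> fst ` live_eigs_cut C"
        then have "fv (Sh_cut C) \<times> {\<alpha>} \<subseteq> R"
          using st C by (fastforce simp: derivation_state_def ordered_cut_def)
        moreover obtain \<beta> where "\<beta> \<in> fv (Sh_cut C)" "\<beta> \<in> ?W" using blocked(4) C by blast
        ultimately show False using \<alpha>(2) by blast
      qed
      have top: "\<exists>A E'. E = EAll A \<alpha> E' \<and> Br E' \<noteq> {}"
        if mem: "E \<in> set Es" and "\<alpha> \<in> fst ` live_eigs E" for E
      proof (cases E)
        case (EEx A tEs)
        with that obtain t F where tF: "(t, F) \<in> set tEs" "\<alpha> \<in> fst ` live_eigs F" by auto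
        with wf_tree[OF mem] EEx have "fv_tm t \<times> {\<alpha>} \<subseteq> R" by fastforce
        moreover have "fv_tm t \<inter> ?W \<noteq> {}"
          using blocked(3) tF(1) mem EEx by metis
        ultimately show ?thesis using \<alpha>(2) by blast
      next
        case (EAll A \<beta> F)
        with that have ne: "Br F \<noteq> {}" by (auto split: if_splits)
        with mem EAll have "(\<beta>, A) \<in> remaining_eigs Cs Es" by (force simp: remaining_eigs_def)
        then have "(\<beta>, \<alpha>) \<notin> R" using \<alpha>(2)[of \<beta>] by force
        with that EAll ne wf_tree[OF mem] show ?thesis by (fastforce split: if_splits)
      qed (use that blocked(1,2) in auto)
      have "\<exists>E\<in>set Es. \<alpha> \<in> fst ` live_eigs E"
        using \<alpha>(1) no_cut unfolding remaining_eigs_def by blast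
      then obtain A E0 where E0: "EAll A \<alpha> E0 \<in> set Es" "Br E0 \<noteq> {}"
        using top by metis
      have mem: "Forall A \<in> \<Gamma>" using wf_tree[OF E0(1)] by simp
      have rA: "(\<alpha>, A) \<in> remaining_eigs Cs Es" using E0 by (force simp: remaining_eigs_def)
      have same: "B = A" if "EAll B \<alpha> F \<in> set Es" "Br F \<noteq> {}" for B F
      proof -
        have "(\<alpha>, B) \<in> remaining_eigs Cs Es" using that by (force simp: remaining_eigs_def)
        with rA st show ?thesis by (auto simp: derivation_state_def dest: single_valuedD)
      qed
      \<comment> \<open>No \<open>+\<^sup>\<alpha>\<close> lies below another one, as \<open>(\<alpha>, \<alpha>) \<in> R\<close> would contradict minimality, so opening
        the roots removes \<open>\<alpha>\<close> from what is still to come, and it may occur in the new formula.\<close>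
      have gone: "\<alpha> \<notin> fst ` live_eigs (strip_Forall \<alpha> E)" if "E \<in> set Es" for E
      proof
        assume a: "\<alpha> \<in> fst ` live_eigs (strip_Forall \<alpha> E)"
        then have "\<alpha> \<in> fst ` live_eigs E"
          using live_eigs_strip_Forall[of \<alpha> E] by blast
        with top[OF that] obtain B F where B: "E = EAll B \<alpha> F" "Br F \<noteq> {}" by blast
        with a wf_tree(3)[OF that] have "(\<alpha>, \<alpha>) \<in> R" by auto
        with \<alpha> show False by blast
      qed
      define Es' where "Es' = map (strip_Forall \<alpha>) Es"
      have rem: "remaining_eigs Cs Es' \<subseteq> remaining_eigs Cs Es"
        using live_eigs_strip_Forall by (fastforce simp: remaining_eigs_def Es'_def)
      have notin: "\<alpha> \<notin> fst ` remaining_eigs Cs Es'"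
        using no_cut gone unfolding remaining_eigs_def Es'_def set_map by blast
      have tree: "Sh E \<in> insert (inst 0 (Var \<alpha>) A) \<Gamma> \<and> expansion_tree E \<and> ordered_by R E"
        if "E \<in> set Es'" for E
      proof -
        from that obtain F where F: "F \<in> set Es" "E = strip_Forall \<alpha> F" by (auto simp: Es'_def)
        from strip_Forall_cases[of \<alpha> F] show ?thesis
        proof (elim disjE exE conjE)
          fix B E' assume *: "F = EAll B \<alpha> E'" "Br E' \<noteq> {}" "strip_Forall \<alpha> F = E'"
          with F same have "B = A" by blast
          with * F wf_tree[OF F(1)] show ?thesis by (auto elim: expansion_tree.cases)
        qed (use F wf_tree in auto)
      qed
      have wfA: "wf_fm (inst 0 (Var \<alpha>) A)"
      proof -
        have "expansion_tree E0" "Sh E0 = inst 0 (Var \<alpha>) A"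
          using wf_tree(2)[OF E0(1)] by (auto elim: expansion_tree.cases)
        then show ?thesis using wf_fm_Sh by metis
      qed
      have "LK c (insert (inst 0 (Var \<alpha>) A) \<Gamma>)"
      proof (rule less.hyps)
        have "(\<Sum>E\<leftarrow>Es. nodes (strip_Forall \<alpha> E)) < (\<Sum>E\<leftarrow>Es. nodes E)"
        proof -
          obtain xs ys where Es: "Es = xs @ EAll A \<alpha> E0 # ys" using E0(1) by (meson split_list)
          have "(\<Sum>E\<leftarrow>zs. nodes (strip_Forall \<alpha> E)) \<le> (\<Sum>E\<leftarrow>zs. nodes E)" for zs
            by (intro sum_list_mono nodes_strip_Forall)
          from this[of xs] this[of ys] show ?thesis using E0(2) by (simp add: Es)
        qed
        then show "state_size Cs Es' < state_size Cs Es"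
          by (simp add: state_size_def Es'_def comp_def)
        show "derivation_state R (insert (inst 0 (Var \<alpha>) A) \<Gamma>) Cs Es'"
        proof (rule derivation_state_step[OF st wfA _ _ tree rem])
          show "\<beta> \<notin> fst ` remaining_eigs Cs Es'" if "\<beta> \<in> fv (inst 0 (Var \<alpha>) A)" for \<beta>
          proof
            assume b: "\<beta> \<in> fst ` remaining_eigs Cs Es'"
            with notin have "\<beta> \<noteq> \<alpha>" by auto
            with that fv_inst[of 0 "Var \<alpha>" A] have "\<beta> \<in> fv (Forall A)" by auto
            moreover have "\<beta> \<in> ?W" using b rem by auto
            ultimately show False using fresh mem by blast
          qed
          show "\<And>I D. D \<in> Dp_proof (Cs, Es) \<Longrightarrow> holds I D \<Longrightarrow> \<exists>D'\<in>Dp_proof (Cs, Es'). holds I D'"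
            by (auto simp: Dp_proof_def Es'_def Dp_strip_Forall image_image)
        qed auto
      qed (use less.prems in auto)
      moreover have "wf_fm (Forall A)" "\<alpha> \<notin> fv (Forall A)"
        using st mem fresh[OF \<alpha>(1) mem] unfolding derivation_state_def by blast+
      ultimately have "LK c (insert (Forall A) \<Gamma>)"
        using fresh[OF \<alpha>(1)] by (intro LK.All) blast+
      with mem show ?thesis by (simp add: insert_absorb)
    qed
  qed
qed


section \<open>Branches and occurrences\<close>

type_synonym ('f, 'p, 'v) branch = "(('f, 'p, 'v) fm + nat) list"

text \<open>
  Liveness ensures that the pattern that weak regularity speaks about, a universal formula followed
  by its instance, occurs on some branch.
\<close>

lemma live_eigs_on_branch:
  "expansion_tree E \<Longrightarrow> (\<alpha>, A) \<in> live_eigs E \<Longrightarrow>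
    \<exists>s s'. s @ [Inl (Forall A), Inl (inst 0 (Var \<alpha>) A)] @ s' \<in> Br E"
proof (induction rule: expansion_tree.induct)
  case (2 E1 E2)
  then obtain i :: nat and s s' where "(i = 1 \<and> s @ [Inl (Forall A), Inl (inst 0 (Var \<alpha>) A)] @ s' \<in> Br E1) \<or>
      (i = 2 \<and> s @ [Inl (Forall A), Inl (inst 0 (Var \<alpha>) A)] @ s' \<in> Br E2)"
    by auto
  then show ?case
    by (intro exI[of _ "Inl (Sh (EAnd E1 E2)) # Inr i # s"] exI[of _ s']) auto
next
  case (3 E1 E2)
  then obtain i :: nat and s s' where "(i = 1 \<and> s @ [Inl (Forall A), Inl (inst 0 (Var \<alpha>) A)] @ s' \<in> Br E1) \<or>
      (i = 2 \<and> s @ [Inl (Forall A), Inl (inst 0 (Var \<alpha>) A)] @ s' \<in> Br E2)"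
    by auto
  then show ?case
    by (intro exI[of _ "Inl (Sh (EOr E1 E2)) # Inr i # s"] exI[of _ s']) auto
next
  case (4 B tEs)
  then obtain t E s s' where tE: "(t, E) \<in> set tEs"
    and "s @ [Inl (Forall A), Inl (inst 0 (Var \<alpha>) A)] @ s' \<in> Br E" by fastforce
  then show ?case
    by (intro exI[of _ "Inl (Exists B) # s"] exI[of _ s']) auto
next
  case (5 B E \<beta>)
  show ?case
  proof (cases "(\<alpha>, A) \<in> live_eigs E")
    case True
    with 5 obtain s s' where "s @ [Inl (Forall A), Inl (inst 0 (Var \<alpha>) A)] @ s' \<in> Br E" by blast
    then show ?thesis
      by (intro exI[of _ "Inl (Forall B) # s"] exI[of _ s']) auto
  next
    case False
    with 5 have "\<beta> = \<alpha>" "B = A" "Br E \<noteq> {}" by (auto split: if_splits)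
    then obtain r where "Inl (inst 0 (Var \<alpha>) A) # r \<in> Br E"
      using Br_starts_with_Sh 5 by fastforce
    with \<open>B = A\<close> show ?thesis
      by (intro exI[of _ "[]"] exI[of _ r]) auto
  qed
qed auto

text \<open>
  Branches record formulas but not which of several \<open>\<exists>\<close>-expansions is followed, so the positions in
  the tree cannot be computed from a branch alone. A function \<open>f\<close> tracks a branch if it assigns to
  each initial part \<open>s\<close> that ends just before a quantified formula the position of the expansion
  taken there, in such a way that expansions further up on the branch dominate those further down.
  The pattern of two consecutive formulas singles out the quantifiers, because a conjunction or
  disjunction is followed by an integer.
\<close>

definition tracks ::
  "(('f, 'p, 'v) branch \<Rightarrow> nat list) \<Rightarrow> ('f, 'p, 'v) etree \<Rightarrow> ('f, 'p, 'v) branch \<Rightarrow> bool" where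
  "tracks f E br \<longleftrightarrow>
     (\<forall>s. f s \<noteq> []) \<and>
     (\<forall>s A t r. br = s @ Inl (Exists A) # Inl (inst 0 t A) # r \<longrightarrow> (f s, ExExp t) \<in> exps E) \<and>
     (\<forall>s A \<alpha> r. br = s @ Inl (Forall A) # Inl (inst 0 (Var \<alpha>) A) # r \<longrightarrow>
        (f s, AllExp \<alpha>) \<in> exps E) \<and>
     (\<forall>s F G r u. br = s @ Inl F # Inl G # r \<longrightarrow> strict_prefix (f s) (f (s @ Inl F # u)))"

text \<open>
  The new root uses up the first two entries of the branch, but only one step of the position.
\<close>

lemma tracks_connective:
  assumes "tracks f E br" and "\<And>p x. (p, x) \<in> exps E \<Longrightarrow> (k # p, x) \<in> exps E'"
  shows "tracks (\<lambda>s. k # f (drop 2 s)) E' (Inl F # Inr i # br)"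
  using assms unfolding tracks_def
  by (auto simp: Cons_eq_append_conv)

lemma tracks_quantifier:
  assumes "tracks f E br" and "\<And>p x. (p, x) \<in> exps E \<Longrightarrow> (k # p, x) \<in> exps E'"
    and "\<And>A t r. F = Exists A \<Longrightarrow> br = Inl (inst 0 t A) # r \<Longrightarrow> ([k], ExExp t) \<in> exps E'"
    and "\<And>A \<alpha> r. F = Forall A \<Longrightarrow> br = Inl (inst 0 (Var \<alpha>) A) # r \<Longrightarrow> ([k], AllExp \<alpha>) \<in> exps E'"
  shows "tracks (\<lambda>s. if s = [] then [k] else k # f (tl s)) E' (Inl F # br)"
proof -
  have "strict_prefix [] (f u)" for u
    using assms(1) unfolding tracks_def by (cases "f u") auto
  with assms show ?thesis
    unfolding tracks_def by (auto simp: Cons_eq_append_conv)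
qed

lemma tracks_exists:
  "expansion_tree E \<Longrightarrow> br \<in> Br E \<Longrightarrow> \<exists>f. tracks f E br"
proof (induction arbitrary: br rule: expansion_tree.induct)
  case (1 b P ts)
  then have "tracks (\<lambda>_. [0]) (ELit b P ts) br"
    by (auto simp: tracks_def Cons_eq_append_conv)
  then show ?case by (intro exI[of _ "\<lambda>_. [0]"])
next
  case (2 E1 E2)
  then obtain i s where "br = Inl (Sh (EAnd E1 E2)) # Inr i # s"
      "(i = 1 \<and> s \<in> Br E1) \<or> (i = 2 \<and> s \<in> Br E2)" by auto
  moreover have "tracks f E1 s \<Longrightarrow> tracks (\<lambda>s. 1 # f (drop 2 s)) (EAnd E1 E2) (Inl F # Inr i # s)"
    "tracks f E2 s \<Longrightarrow> tracks (\<lambda>s. 2 # f (drop 2 s)) (EAnd E1 E2) (Inl F # Inr i # s)" for f F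
    by (erule tracks_connective; simp)+
  ultimately show ?case using 2(3,4) by blast
next
  case (3 E1 E2)
  then obtain i s where "br = Inl (Sh (EOr E1 E2)) # Inr i # s"
      "(i = 1 \<and> s \<in> Br E1) \<or> (i = 2 \<and> s \<in> Br E2)" by auto
  moreover have "tracks f E1 s \<Longrightarrow> tracks (\<lambda>s. 1 # f (drop 2 s)) (EOr E1 E2) (Inl F # Inr i # s)"
    "tracks f E2 s \<Longrightarrow> tracks (\<lambda>s. 2 # f (drop 2 s)) (EOr E1 E2) (Inl F # Inr i # s)" for f F
    by (erule tracks_connective; simp)+
  ultimately show ?case using 3(3,4) by blast
next
  case (4 A tEs)
  then obtain t E s where tE: "(t, E) \<in> set tEs" "s \<in> Br E" "br = Inl (Exists A) # s" by auto
  then obtain i where i: "i < length tEs" "tEs ! i = (t, E)" by (metis in_set_conv_nth)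
  have "tracks f E s \<Longrightarrow>
      tracks (\<lambda>s. if s = [] then [i] else i # f (tl s)) (EEx A tEs) br" for f
    unfolding tE(3)
  proof (rule tracks_quantifier)
    fix B u r assume "Exists A = Exists B" "s = Inl (inst 0 u B) # r"
    moreover have "\<exists>r. s = Inl (inst 0 t A) # r"
      using Br_starts_with_Sh[OF tE(2)] 4(2)[OF tE(1)] by auto
    ultimately have "u = t"
      using inst_inject[of 0 u A t] 4(1) by (auto simp: wf_fm_def)
    with i show "([i], ExExp u) \<in> exps (EEx A tEs)" by force
  qed (use i in auto)
  with 4(2)[OF tE(1)] tE(2) show ?case by blast
next
  case (5 A E \<alpha>)
  then obtain s where s: "s \<in> Br E" "br = Inl (Forall A) # s" by auto
  have "tracks f E s \<Longrightarrow>
      tracks (\<lambda>s. if s = [] then [0] else 0 # f (tl s)) (EAll A \<alpha> E) br" for f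
    unfolding s(2)
  proof (rule tracks_quantifier)
    fix B \<beta> r assume "Forall A = Forall B" "s = Inl (inst 0 (Var \<beta>) B) # r"
    moreover have "\<exists>r. s = Inl (inst 0 (Var \<alpha>) A) # r"
      using Br_starts_with_Sh[OF s(1)] 5(3) by auto
    ultimately have "\<beta> = \<alpha>"
      using inst_inject[of 0 "Var \<beta>" A "Var \<alpha>"] 5(1) by (auto simp: wf_fm_def)
    then show "([0], AllExp \<beta>) \<in> exps (EAll A \<alpha> E)" by simp
  qed auto
  with 5(4) s(1) show ?case by blast
qed

section \<open>Precedence between eigenvariables\<close>

text \<open>
  \<open>s\<close> is the part of a branch up to and including some universal formula; the predicate says that
  \<open>\<beta>\<close> precedes the eigenvariable of that formula. The three disjuncts are the cut formula, the term
  of a dominating \<open>\<exists>\<close>-expansion, and a dominating \<open>\<forall>\<close>-expansion. A branch of either half of a cut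
  starts with the cut formula or its dual, which have the same variables. Everything is
  expressed by \<open>s\<close>, so that weak regularity transfers it to all occurrences of the eigenvariable.
\<close>

definition waits_for :: "bool \<Rightarrow> ('f, 'p, 'v) branch \<Rightarrow> 'v \<Rightarrow> bool" where
  "waits_for in_cut s \<beta> \<longleftrightarrow>
     (in_cut \<and> (\<exists>F r. s = Inl F # r \<and> \<beta> \<in> fv F)) \<or>
     (\<exists>u A t r. s = u @ Inl (Exists A) # Inl (inst 0 t A) # r \<and> \<beta> \<in> fv_tm t) \<or>
     (\<exists>u A r. s = u @ Inl (Forall A) # Inl (inst 0 (Var \<beta>) A) # r)"

lemma waits_forI:
  "\<beta> \<in> fv_tm t \<Longrightarrow> waits_for c (u @ Inl (Exists A) # Inl (inst 0 t A) # r) \<beta>"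
  "waits_for c (u @ Inl (Forall A) # Inl (inst 0 (Var \<beta>) A) # r) \<beta>"
  unfolding waits_for_def by blast+

fun in_cut :: "place \<Rightarrow> bool" where
  "in_cut (CutL i) \<longleftrightarrow> True"
| "in_cut (CutR i) \<longleftrightarrow> True"
| "in_cut (InTree i) \<longleftrightarrow> False"

text \<open>
  A live occurrence of \<open>+\<^sup>\<alpha>\<close> in the tree \<open>T\<close> at place \<open>l\<close>, given by a branch \<open>br\<close> through it and the
  part \<open>s\<close> of \<open>br\<close> above it.
\<close>

definition eigen_at :: "('f, 'p, 'v) eproof \<Rightarrow> place \<Rightarrow> ('f, 'p, 'v) etree \<Rightarrow>
    ('f, 'p, 'v) branch \<Rightarrow> ('f, 'p, 'v) branch \<Rightarrow> 'v \<Rightarrow> ('f, 'p, 'v) fm \<Rightarrow> bool" where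
  "eigen_at \<P> l T br s \<alpha> A \<longleftrightarrow> tree_at \<P> l T \<and> br \<in> Br T \<and>
     (\<exists>r. br = s @ [Inl (Forall A), Inl (inst 0 (Var \<alpha>) A)] @ r)"

definition eigen_order :: "('f, 'p, 'v) eproof \<Rightarrow> ('v \<times> 'v) set" where
  "eigen_order \<P> = {(\<beta>, \<alpha>). \<exists>l T br s A.
     eigen_at \<P> l T br s \<alpha> A \<and> waits_for (in_cut l) (s @ [Inl (Forall A)]) \<beta>}"

lemma tree_at_exists:
  shows "C \<in> set Cs \<Longrightarrow> \<exists>i. tree_at (Cs, Es) (CutL i) (fst C) \<and> tree_at (Cs, Es) (CutR i) (snd C)"
    and "E \<in> set Es \<Longrightarrow> \<exists>i. tree_at (Cs, Es) (InTree i) E"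
  by (auto simp: in_set_conv_nth)

lemma tree_at_expansion_tree:
  assumes "expansion_proof \<P>" and "tree_at \<P> l T"
  shows "expansion_tree T"
  using assms by (cases \<P>; cases l) (auto simp: expansion_proof_def is_cut_def)

text \<open>
  Weak regularity in terms of places. It compares cuts as a whole, whose branches are those of two
  trees.
\<close>

lemma eigen_at_unique:
  assumes "expansion_proof \<P>" and "eigen_at \<P> l T br s \<alpha> A" and "eigen_at \<P> l' T' br' s' \<alpha> A'"
  shows "s = s'" "A = A'" "in_cut l = in_cut l'"
proof -
  have el: "\<exists>S\<in>elements \<P>. isl S = in_cut l \<and> Br T \<subseteq> Br_element S" if "tree_at \<P> l T" for l T
  proof (cases l)
    case (CutL i)
    with that show ?thesis
      by (intro bexI[of _ "Inl (fst \<P> ! i)"])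
        (cases \<P>; auto simp: elements_def Br_element_def Br_cut_def)+
  next
    case (CutR i)
    with that show ?thesis
      by (intro bexI[of _ "Inl (fst \<P> ! i)"])
        (cases \<P>; auto simp: elements_def Br_element_def Br_cut_def)+
  next
    case (InTree i)
    with that show ?thesis
      by (intro bexI[of _ "Inr (snd \<P> ! i)"])
        (cases \<P>; auto simp: elements_def Br_element_def)+
  qed
  obtain r where T: "tree_at \<P> l T" "s @ [Inl (Forall A), Inl (inst 0 (Var \<alpha>) A)] @ r \<in> Br T"
    using assms(2) unfolding eigen_at_def by blast
  obtain r' where T': "tree_at \<P> l' T'"
      "s' @ [Inl (Forall A'), Inl (inst 0 (Var \<alpha>) A')] @ r' \<in> Br T'"
    using assms(3) unfolding eigen_at_def by blast
  obtain S where S: "S \<in> elements \<P>" "isl S = in_cut l"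
      "s @ [Inl (Forall A), Inl (inst 0 (Var \<alpha>) A)] @ r \<in> Br_element S"
    using el[OF T(1)] T(2) by blast
  obtain S' where S': "S' \<in> elements \<P>" "isl S' = in_cut l'"
      "s' @ [Inl (Forall A'), Inl (inst 0 (Var \<alpha>) A')] @ r' \<in> Br_element S'"
    using el[OF T'(1)] T'(2) by blast
  have "weakly_regular \<P>" using assms(1) by (simp add: expansion_proof_def)
  then have "s = s' \<and> A = A' \<and> (isl S' \<longleftrightarrow> isl S)"
    unfolding weakly_regular_def using S S' by blast
  with S(2) S'(2) show "s = s'" "A = A'" "in_cut l = in_cut l'" by auto
qed

lemma finite_exps: "finite (exps E)"
proof (induction E)
  case (EEx A tEs)
  have "exps (EEx A tEs) \<subseteq> (\<lambda>i. ([i], ExExp (fst (tEs ! i)))) ` {..<length tEs} \<union>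
      (\<Union>i<length tEs. (\<lambda>(p, x). (i # p, x)) ` exps (snd (tEs ! i)))"
    by (force simp: case_prod_beta)
  moreover have "finite (exps (snd (tEs ! i)))" if "i < length tEs" for i
    using EEx[of "tEs ! i" "snd (tEs ! i)"] that by (cases "tEs ! i") (auto dest: nth_mem)
  ultimately show ?case by (intro finite_subset[of "exps (EEx A tEs)"]) auto
next
  case (EAnd E1 E2)
  have "exps (EAnd E1 E2) = (\<lambda>(p, x). (1 # p, x)) ` exps E1 \<union> (\<lambda>(p, x). (2 # p, x)) ` exps E2"
    by force
  with EAnd show ?case by simp
next
  case (EOr E1 E2)
  have "exps (EOr E1 E2) = (\<lambda>(p, x). (1 # p, x)) ` exps E1 \<union> (\<lambda>(p, x). (2 # p, x)) ` exps E2"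
    by force
  with EOr show ?case by simp
next
  case (EAll A \<alpha> E)
  have "exps (EAll A \<alpha> E) = insert ([0], AllExp \<alpha>) ((\<lambda>(p, x). (0 # p, x)) ` exps E)"
    by force
  with EAll show ?case by simp
qed simp

lemma finite_expansion_at: "finite {ExpOcc l p | l p. \<exists>x. expansion_at \<P> l p x}"
proof -
  obtain Cs Es where P: "\<P> = (Cs, Es)" by (cases \<P>)
  let ?places = "CutL ` {..<length Cs} \<union> CutR ` {..<length Cs} \<union> InTree ` {..<length Es}"
  have place: "l \<in> ?places" if "tree_at \<P> l T" for l T
    using that by (cases l) (auto simp: P)
  have "{ExpOcc l p | l p. \<exists>x. expansion_at \<P> l p x} \<subseteq>
      (\<Union>l\<in>?places. \<Union>T\<in>{T. tree_at \<P> l T}. (\<lambda>(p, x). ExpOcc l p) ` exps T)"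
  proof clarify
    fix l p x assume "expansion_at \<P> l p x"
    then obtain T where T: "tree_at \<P> l T" "(p, x) \<in> exps T" by (auto simp: expansion_at_def)
    then have "ExpOcc l p \<in> (\<lambda>(p, x). ExpOcc l p) ` exps T" by (intro image_eqI) auto
    with T(1) show "ExpOcc l p \<in> (\<Union>l\<in>?places. \<Union>T\<in>{T. tree_at \<P> l T}. (\<lambda>(p, x). ExpOcc l p) ` exps T)"
      by (intro UN_I[of l, OF place] UN_I[of T]) simp_all
  qed
  moreover have "finite {T. tree_at \<P> l T}" for l
    by (cases l) (auto simp: P)
  ultimately show ?thesis
    by (elim finite_subset) (auto intro: finite_exps)
qed

lemma wf_dep:
  assumes "\<nexists>v. dep \<P> v v"
  shows "wfp (dep \<P>)"
proof -
  let ?r = "{(v, w). dep0 \<P> v w}"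
  let ?O = "{ExpOcc l p | l p. \<exists>x. expansion_at \<P> l p x} \<union> CutOcc ` {..<length (fst \<P>)}"
  have "v \<in> ?O \<and> w \<in> ?O" if "dep0 \<P> v w" for v w
    using that
  proof cases
    case (cut_exp l p x i)
    then show ?thesis by (cases \<P>) (fastforce simp: expansion_at_def)
  qed blast+
  then have "?r \<subseteq> ?O \<times> ?O" by blast
  then have "finite ?r" by (rule finite_subset) (auto intro: finite_expansion_at)
  moreover have dep: "dep \<P> v w \<longleftrightarrow> (v, w) \<in> ?r\<^sup>+" for v w
    by (simp add: dep_def trancl_def)
  then have "acyclic ?r" using assms by (simp add: acyclic_def)
  ultimately have "wf (?r\<^sup>+)" by (intro wf_trancl finite_acyclic_wf)
  then show ?thesis by (simp add: wfp_def dep)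
qed

text \<open>
  If \<open>\<beta>\<close> precedes \<open>\<alpha>\<close>, then below any given live occurrence of \<open>+\<^sup>\<alpha>\<close> in the dependency relation
  there is a live occurrence of \<open>+\<^sup>\<beta>\<close>. If \<open>\<beta>\<close> comes from a term or a cut formula, every occurrence of
  \<open>+\<^sup>\<beta>\<close> will do, in particular the one assumed to exist; if \<open>+\<^sup>\<beta>\<close> dominates \<open>+\<^sup>\<alpha>\<close>, it is the one on
  the same branch.
\<close>

lemma dep_from_waits_for:
  assumes P: "expansion_proof \<P>" and at: "eigen_at \<P> l T br s \<alpha> A" and tr: "tracks f T br"
    and con: "waits_for (in_cut l) (s @ [Inl (Forall A)]) \<beta>"
    and at': "eigen_at \<P> l' T' br' s' \<beta> B" and tr': "tracks f' T' br'"
  shows "\<exists>l' T' br' s' B f'. eigen_at \<P> l' T' br' s' \<beta> B \<and> tracks f' T' br' \<and>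
    dep \<P> (ExpOcc l' (f' s')) (ExpOcc l (f s))"
proof -
  obtain r where br: "br = s @ Inl (Forall A) # Inl (inst 0 (Var \<alpha>) A) # r"
    and T: "tree_at \<P> l T" "br \<in> Br T"
    using at by (auto simp: eigen_at_def)
  have exp: "expansion_at \<P> l (f s) (AllExp \<alpha>)"
    using tr br T by (auto simp: tracks_def expansion_at_def)
  have exp': "expansion_at \<P> l' (f' s') (AllExp \<beta>)"
    using tr' at' by (auto simp: tracks_def expansion_at_def eigen_at_def)
  consider (cut) F u where "in_cut l" "s @ [Inl (Forall A)] = Inl F # u" "\<beta> \<in> fv F"
    | (ex) u D t v where "s @ [Inl (Forall A)] = u @ Inl (Exists D) # Inl (inst 0 t D) # v" "\<beta> \<in> fv_tm t"
    | (all) u D v where "s @ [Inl (Forall A)] = u @ Inl (Forall D) # Inl (inst 0 (Var \<beta>) D) # v"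
    using con by (auto simp: waits_for_def)
  then show ?thesis
  proof cases
    case cut
    obtain i where i: "l = CutL i \<or> l = CutR i" using cut(1) by (cases l) auto
    obtain u' where "br = Inl (Sh T) # u'" using Br_starts_with_Sh T(2) by blast
    moreover have "br = Inl F # u @ Inl (inst 0 (Var \<alpha>) A) # r"
      using br cut(2) by (metis append.assoc append_Cons append_Nil)
    ultimately have "F = Sh T" by simp
    moreover have il: "i < length (fst \<P>)" using i T(1) by (cases \<P>) auto
    moreover have "is_cut (fst \<P> ! i)" using P il by (simp add: expansion_proof_def)
    ultimately have "\<beta> \<in> fv (Sh_cut (fst \<P> ! i))"
      using i T(1) cut(3) by (cases \<P>) (auto simp: is_cut_def Sh_cut_def fv_dual)
    with exp' il have "dep0 \<P> (ExpOcc l' (f' s')) (CutOcc i)" by (intro dep0.eigen_cut)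
    moreover have "dep0 \<P> (CutOcc i) (ExpOcc l (f s))" using exp i by (rule dep0.cut_exp)
    ultimately have "dep \<P> (ExpOcc l' (f' s')) (ExpOcc l (f s))"
      unfolding dep_def by (rule tranclp.trancl_into_trancl[OF tranclp.r_into_trancl])
    with at' tr' show ?thesis by blast
  next
    case ex
    then have s: "s = u @ Inl (Exists D) # butlast (Inl (inst 0 t D) # v)"
      by (metis append_butlast_last_id butlast_append butlast_snoc butlast.simps(2) list.distinct(1))
    have br': "br = u @ Inl (Exists D) # Inl (inst 0 t D) # v @ Inl (inst 0 (Var \<alpha>) A) # r"
      using br ex(1) by (metis append.assoc append_Cons append_Nil)
    have "expansion_at \<P> l (f u) (ExExp t)"
      using tr br' T by (auto simp: tracks_def expansion_at_def)
    moreover have "strict_prefix (f u) (f s)"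
      using tr br' s unfolding tracks_def by blast
    ultimately have "dep0 \<P> (ExpOcc l' (f' s')) (ExpOcc l (f u))" "dep0 \<P> (ExpOcc l (f u)) (ExpOcc l (f s))"
      using exp exp' ex(2) by (auto intro: dep0.intros)
    then have "dep \<P> (ExpOcc l' (f' s')) (ExpOcc l (f s))"
      unfolding dep_def by (rule tranclp.trancl_into_trancl[OF tranclp.r_into_trancl])
    with at' tr' show ?thesis by blast
  next
    case all
    then have s: "s = u @ Inl (Forall D) # butlast (Inl (inst 0 (Var \<beta>) D) # v)"
      by (metis append_butlast_last_id butlast_append butlast_snoc butlast.simps(2) list.distinct(1))
    have br': "br = u @ Inl (Forall D) # Inl (inst 0 (Var \<beta>) D) # v @ Inl (inst 0 (Var \<alpha>) A) # r"
      using br all by (metis append.assoc append_Cons append_Nil)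
    have "expansion_at \<P> l (f u) (AllExp \<beta>)"
      using tr br' T by (auto simp: tracks_def expansion_at_def)
    moreover have "strict_prefix (f u) (f s)"
      using tr br' s unfolding tracks_def by blast
    ultimately have "dep \<P> (ExpOcc l (f u)) (ExpOcc l (f s))"
      unfolding dep_def using exp by (auto intro: dep0.dominates)
    moreover have "eigen_at \<P> l T br u \<beta> D"
      using T br' by (auto simp: eigen_at_def)
    ultimately show ?thesis using tr by blast
  qed
qed

text \<open>
  Accessibility of \<open>\<alpha>\<close> is proved by induction on an occurrence of \<open>+\<^sup>\<alpha>\<close>, which
  \<open>dep_from_waits_for\<close> replaces by a smaller one for each predecessor of \<open>\<alpha>\<close>.
\<close>

lemma wf_eigen_order:
  assumes P: "expansion_proof \<P>"
  shows "wf (eigen_order \<P>)"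
proof -
  have tracked: "\<exists>f. tracks f T br" if "eigen_at \<P> l T br s \<alpha> A" for l T br s \<alpha> A
    using that tree_at_expansion_tree[OF P] tracks_exists unfolding eigen_at_def by blast
  have wfd: "wfp (dep \<P>)" using P by (intro wf_dep) (simp add: expansion_proof_def)
  have acc: "\<alpha> \<in> Wellfounded.acc (eigen_order \<P>)"
    if "eigen_at \<P> l T br s \<alpha> A" "tracks f T br" "v = ExpOcc l (f s)" for v l T br s \<alpha> A f
    using wfd that
  proof (induction v arbitrary: l T br s \<alpha> A f rule: wfp_induct_rule)
    case (less v)
    show ?case
    proof (rule accI)
      fix \<beta> assume "(\<beta>, \<alpha>) \<in> eigen_order \<P>"
      then obtain l2 T2 br2 s2 A2 where "eigen_at \<P> l2 T2 br2 s2 \<alpha> A2"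
          "waits_for (in_cut l2) (s2 @ [Inl (Forall A2)]) \<beta>"
        by (auto simp: eigen_order_def)
      \<comment> \<open>The occurrence that shows that \<open>\<beta>\<close> precedes \<open>\<alpha>\<close> need not be the given one; both have the
        same branch above them and are alike in being in a cut or not, which is all that matters.\<close>
      with eigen_at_unique[OF P this(1) less.prems(1)]
      have con: "waits_for (in_cut l) (s @ [Inl (Forall A)]) \<beta>" by simp
      show "\<beta> \<in> Wellfounded.acc (eigen_order \<P>)"
      proof (cases "\<exists>\<gamma>. (\<gamma>, \<beta>) \<in> eigen_order \<P>")
        case True
        then obtain l' T' br' s' B where at': "eigen_at \<P> l' T' br' s' \<beta> B"
          by (auto simp: eigen_order_def)
        then obtain f' where "tracks f' T' br'" using tracked by blast
        from dep_from_waits_for[OF P less.prems(1,2) con at' this] less.IH less.prems(3)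
        show ?thesis by blast
      next
        case False
        \<comment> \<open>In particular, variables of terms and cut formulas that are not live eigenvariables.\<close>
        then show ?thesis by (auto intro: accI)
      qed
    qed
  qed
  show ?thesis
  proof (rule acc_wfI, rule allI, rule accI)
    fix \<alpha> \<beta> assume "(\<beta>, \<alpha>) \<in> eigen_order \<P>"
    moreover from this obtain l T br s A where "eigen_at \<P> l T br s \<alpha> A"
      by (auto simp: eigen_order_def)
    ultimately show "\<beta> \<in> Wellfounded.acc (eigen_order \<P>)"
      using tracked acc acc_downward by metis
  qed
qed

section \<open>Expansion proofs as initial stages\<close>

text \<open>
  The list \<open>u\<close> leads from the root of \<open>T\<close> to the subtree \<open>E\<close>; it allows the induction on \<open>E\<close> to refer
  to complete branches of \<open>T\<close>.
\<close>

lemma ordered_by_eigen_order: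
  assumes "expansion_tree E" and "tree_at \<P> l T" and "\<And>b. b \<in> Br E \<Longrightarrow> u @ b \<in> Br T"
  shows "ordered_by (eigen_order \<P>) E"
  using assms(1,3)
proof (induction arbitrary: u rule: expansion_tree.induct)
  case (2 E1 E2)
  from 2(3)[of "u @ [Inl (Sh (EAnd E1 E2)), Inr 1]"] 2(4)[of "u @ [Inl (Sh (EAnd E1 E2)), Inr 2]"] 2(5)
  show ?case by auto
next
  case (3 E1 E2)
  from 3(3)[of "u @ [Inl (Sh (EOr E1 E2)), Inr 1]"] 3(4)[of "u @ [Inl (Sh (EOr E1 E2)), Inr 2]"] 3(5)
  show ?case by auto
next
  case (4 A tEs)
  have "ordered_by (eigen_order \<P>) E \<and> fv_tm t \<times> fst ` live_eigs E \<subseteq> eigen_order \<P>"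
    if tE: "(t, E) \<in> set tEs" for t E
  proof (intro conjI subsetI)
    have sub: "(u @ [Inl (Exists A)]) @ b \<in> Br T" if "b \<in> Br E" for b
      using that tE 4(3)[of "Inl (Exists A) # b"] by auto
    with 4(2)[OF tE] show "ordered_by (eigen_order \<P>) E" by blast
    fix x assume "x \<in> fv_tm t \<times> fst ` live_eigs E"
    then obtain \<beta> \<alpha> B where x: "x = (\<beta>, \<alpha>)" "\<beta> \<in> fv_tm t" "(\<alpha>, B) \<in> live_eigs E" by auto
    obtain s s' where b: "s @ [Inl (Forall B), Inl (inst 0 (Var \<alpha>) B)] @ s' \<in> Br E" (is "?b \<in> _")
      using live_eigs_on_branch[OF _ x(3)] 4(2)[OF tE] by blast
    obtain w where w: "s @ [Inl (Forall B)] = Inl (inst 0 t A) # w"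
      using Br_starts_with_Sh[OF b] 4(2)[OF tE] by (cases s) auto
    have "eigen_at \<P> l T (u @ [Inl (Exists A)] @ ?b) (u @ Inl (Exists A) # s) \<alpha> B"
      using assms(2) sub[OF b] by (auto simp: eigen_at_def)
    moreover have "waits_for (in_cut l) ((u @ Inl (Exists A) # s) @ [Inl (Forall B)]) \<beta>"
      using w waits_forI(1)[OF x(2), of _ u A w] by simp
    ultimately show "x \<in> eigen_order \<P>" unfolding eigen_order_def x(1) by blast
  qed
  then show ?case unfolding ordered_by.simps by blast
next
  case (5 A E \<gamma>)
  have sub: "(u @ [Inl (Forall A)]) @ b \<in> Br T" if "b \<in> Br E" for b
    using that 5(5)[of "Inl (Forall A) # b"] by auto
  have "(\<gamma>, \<alpha>) \<in> eigen_order \<P>" if \<alpha>: "(\<alpha>, B) \<in> live_eigs E" for \<alpha> B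
  proof -
    obtain s s' where b: "s @ [Inl (Forall B), Inl (inst 0 (Var \<alpha>) B)] @ s' \<in> Br E" (is "?b \<in> _")
      using live_eigs_on_branch[OF 5(2) \<alpha>] by blast
    obtain w where w: "s @ [Inl (Forall B)] = Inl (inst 0 (Var \<gamma>) A) # w"
      using Br_starts_with_Sh[OF b] 5(3) by (cases s) auto
    have "eigen_at \<P> l T (u @ [Inl (Forall A)] @ ?b) (u @ Inl (Forall A) # s) \<alpha> B"
      using assms(2) sub[OF b] by (auto simp: eigen_at_def)
    moreover have "waits_for (in_cut l) ((u @ Inl (Forall A) # s) @ [Inl (Forall B)]) \<gamma>"
      using w waits_forI(2)[of _ u A \<gamma> w] by simp
    ultimately show ?thesis unfolding eigen_order_def by blast
  qed
  with 5(4)[OF sub] show ?case by auto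
qed auto

lemma live_eigs_eigen_at:
  assumes "expansion_proof \<P>" and "tree_at \<P> l T" and "(\<alpha>, A) \<in> live_eigs T"
  shows "\<exists>br s. eigen_at \<P> l T br s \<alpha> A"
  using live_eigs_on_branch[OF tree_at_expansion_tree[OF assms(1,2)] assms(3)] assms(2)
  by (auto simp: eigen_at_def)

lemma remaining_eigs_eigen_at:
  assumes "expansion_proof (Cs, Es)" and "(\<alpha>, A) \<in> remaining_eigs Cs Es"
  shows "\<exists>l T br s. eigen_at (Cs, Es) l T br s \<alpha> A"
proof -
  from assms(2) consider C where "C \<in> set Cs" "(\<alpha>, A) \<in> live_eigs (fst C)"
    | C where "C \<in> set Cs" "(\<alpha>, A) \<in> live_eigs (snd C)" | E where "E \<in> set Es" "(\<alpha>, A) \<in> live_eigs E"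
    by (auto simp: remaining_eigs_def live_eigs_cut_def)
  then have "\<exists>l T. tree_at (Cs, Es) l T \<and> (\<alpha>, A) \<in> live_eigs T"
    using tree_at_exists by cases blast+
  then show ?thesis using live_eigs_eigen_at[OF assms(1)] by blast
qed

lemma ordered_cut_eigen_order:
  assumes P: "expansion_proof (Cs, Es)" and C: "C \<in> set Cs"
  shows "ordered_cut (eigen_order (Cs, Es)) C"
proof -
  let ?R = "eigen_order (Cs, Es)"
  obtain i where i: "tree_at (Cs, Es) (CutL i) (fst C)" "tree_at (Cs, Es) (CutR i) (snd C)"
    using tree_at_exists(1)[OF C] by blast
  have cut: "is_cut C" using P C by (auto simp: expansion_proof_def)
  have side: "ordered_by ?R T \<and> fv (Sh_cut C) \<times> fst ` live_eigs T \<subseteq> ?R"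
    if at: "tree_at (Cs, Es) l T" and l: "in_cut l" and fv: "fv (Sh T) = fv (Sh_cut C)" for l T
  proof
    show "ordered_by ?R T"
      using ordered_by_eigen_order[OF tree_at_expansion_tree[OF P at] at, of "[]"] by simp
    show "fv (Sh_cut C) \<times> fst ` live_eigs T \<subseteq> ?R"
    proof clarify
      fix \<beta> \<alpha> A assume \<beta>: "\<beta> \<in> fv (Sh_cut C)" and "(\<alpha>, A) \<in> live_eigs T"
      then obtain br s where e: "eigen_at (Cs, Es) l T br s \<alpha> A"
        using live_eigs_eigen_at[OF P at] by blast
      then obtain w where "s @ [Inl (Forall A)] = Inl (Sh T) # w"
        using Br_starts_with_Sh[of br T] by (cases s) (auto simp: eigen_at_def)
      with l \<beta> fv have "waits_for (in_cut l) (s @ [Inl (Forall A)]) \<beta>"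
        by (auto simp: waits_for_def)
      with e have "(\<beta>, \<alpha>) \<in> ?R" unfolding eigen_order_def by blast
      then show "(\<beta>, fst (\<alpha>, A)) \<in> ?R" by simp
    qed
  qed
  from side[OF i(1)] side[OF i(2)] cut show ?thesis
    by (auto simp: ordered_cut_def live_eigs_cut_def is_cut_def Sh_cut_def fv_dual)
qed

text \<open>
  Each condition on expansion proofs supplies one invariant: weak regularity gives
  single-valuedness, and the eigenvariable condition gives freshness.
\<close>

lemma derivation_state_of_expansion_proof:
  assumes P: "expansion_proof (Cs, Es)"
  shows "derivation_state (eigen_order (Cs, Es)) (Sh ` set Es) Cs Es"
proof -
  have "ordered_by (eigen_order (Cs, Es)) E" if E: "E \<in> set Es" for E
  proof -
    obtain i where at: "tree_at (Cs, Es) (InTree i) E" using tree_at_exists(2)[OF E] by blast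
    show ?thesis
      using ordered_by_eigen_order[OF tree_at_expansion_tree[OF P at] at, of "[]"] by simp
  qed
  moreover have "single_valued (remaining_eigs Cs Es)"
    using remaining_eigs_eigen_at[OF P] eigen_at_unique(2)[OF P] unfolding single_valued_def by meson
  moreover have "\<alpha> \<notin> fv B" if r: "(\<alpha>, A) \<in> remaining_eigs Cs Es" and B: "B \<in> Sh ` set Es" for \<alpha> A B
  proof -
    obtain l T br s where e: "eigen_at (Cs, Es) l T br s \<alpha> A"
      using remaining_eigs_eigen_at[OF P r] by blast
    then obtain f where "tracks f T br"
      using tracks_exists tree_at_expansion_tree[OF P] unfolding eigen_at_def by blast
    with e have "expansion_at (Cs, Es) l (f s) (AllExp \<alpha>)"
      by (auto simp: tracks_def eigen_at_def expansion_at_def)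
    with P B show ?thesis
      by (auto simp: expansion_proof_def eigenvariable_condition_def Sh_proof_def)
  qed
  moreover have "is_cut C \<and> ordered_cut (eigen_order (Cs, Es)) C" if "C \<in> set Cs" for C
    using ordered_cut_eigen_order[OF P that] P that by (simp add: expansion_proof_def)
  moreover have "expansion_tree E \<and> wf_fm (Sh E)" if "E \<in> set Es" for E
    using P that wf_fm_Sh by (auto simp: expansion_proof_def)
  moreover have "tautology (Dp_proof (Cs, Es))"
    using P by (simp add: expansion_proof_def)
  ultimately show ?thesis
    unfolding derivation_state_def by auto
qed

theorem theorem3:
  fixes \<P> :: "('f, 'p, 'v) eproof" and \<Gamma> :: "('f, 'p, 'v) fm set"
  assumes "expansion_proof \<P>" and "Sh_proof \<P> = \<Gamma>"
  shows "LK_provable \<Gamma> \<and> (cut_free \<P> \<longrightarrow> LK_cutfree_provable \<Gamma>)"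
proof -
  obtain Cs Es where P: "\<P> = (Cs, Es)" by (cases \<P>)
  have "LK c \<Gamma>" if "Cs \<noteq> [] \<Longrightarrow> c" for c
    using LK_of_derivation_state[OF wf_eigen_order derivation_state_of_expansion_proof, of Cs Es c] that
      assms by (simp add: P Sh_proof_def)
  then show ?thesis
    by (simp add: LK_provable_def LK_cutfree_provable_def cut_free_def P)
qed

end
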